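(* Let $p\in(1,\infty)$, $s\in(0,1)$, and let $u\in W^{s,p}(\mathbb{R}^n)$ be a weak subsolution to the problem $\mathcal{L}u=0$ in $\Omega$, $u=g$ in $\mathbb{R}^n\setminus\Omega$ (in the sense defined in the context). Let $B_r\equiv B_r(x_0)\subset\Omega$. Then for every $\delta\in(0,1]$, \[ \operatorname*{ess\,sup}_{B_{r/2}(x_0)} u\;\le\;\delta\,\mathrm{Tail}(u_+;x_0,r/2)+c\,\delta^{-\frac{(p-1)n}{sp^2}}\left(\frac{1}{|B_r(x_0)|}\int_{B_r(x_0)}u_+^p\,dx\right)^{1/p}, \] where $u_+=\max\{u,0\}$ and the constant $c>0$ depends only on $n,p,s,\lambda,\Lambda$.
   Context: Fix $n\ge1$, $s\in(0,1)$, $p>1$, and constants $1\le\lambda\le\Lambda$. The kernel $K:\mathbb{R}^n\times\mathbb{R}^n\to[0,\infty)$ is measurable, symmetric ($K(x,y)=K(y,x)$), and satisfies $\lambda\le K(x,y)|x-y|^{n+sp}\le\Lambda$ for a.e. $x,y\in\mathbb{R}^n$. $W^{s,p}(\mathbb{R}^n)$ is the set of $v\in L^p(\mathbb{R}^n)$ with $\int\int |v(x)-v(y)|^p|x-y|^{-n-sp}\,dx\,dy<\infty$; $W^{s,p}_0(\Omega)$ is the set of $v\in W^{s,p}(\mathbb{R}^n)$ with $v=0$ a.e. in $\mathbb{R}^n\setminus\Omega$. $\Omega\subset\mathbb{R}^n$ is a bounded open set and $g\in W^{s,p}(\mathbb{R}^n)$. Define $\mathcal{K}_g^{\pm}(\Omega)=\{v\in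 W^{s,p}(\mathbb{R}^n):(g-v)_\pm\in W^{s,p}_0(\Omega)\}$ and $\mathcal{K}_g(\Omega)=\{v\in W^{s,p}(\mathbb{R}^n): v-g\in W^{s,p}_0(\Omega)\}$, where $a_+=\max\{a,0\}$, $a_-=\max\{-a,0\}$. A function $u\in\mathcal{K}^-_g$ (resp. $u\in\mathcal{K}^+_g$) is a weak subsolution (resp. supersolution) to "$\mathcal{L}u=0$ in $\Omega$, $u=g$ in $\mathbb{R}^n\setminus\Omega$" if \[\int_{\mathbb{R}^n}\int_{\mathbb{R}^n}K(x,y)|u(x)-u(y)|^{p-2}(u(x)-u(y))(\eta(x)-\eta(y))\,dx\,dy\le0\ (\text{resp. }\ge0)\] for every nonnegative $\eta\in W^{s,p}_0(\Omega)$; a weak solution is both (equivalently $u\in\mathcal{K}_g$ and the integral equals $0$ for all $\eta\in W_0^{s,p}(\Omega)$). The nonlocal tail of $v\in W^{s,p}(\mathbb{R}^n)$ is \[\mathrm{Tail}(v;x_0,R)=\Big[R^{sp}\int_{\mathbb{R}^n\setminus B_R(x_0)}|v(x)|^{p-1}|x-x_0|^{-n-sp}\,dx\Big]^{1/(p-1)}.\] *)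

theory Defs
  imports "HOL-Analysis.Analysis" "HOL-Probability.Essential_Supremum"
begin

definition Wsp :: "real \<Rightarrow> real \<Rightarrow> ('a::euclidean_space \<Rightarrow> real) \<Rightarrow> bool" where
  "Wsp s p v \<longleftrightarrow> v \<in> borel_measurable lebesgue
     \<and> (\<integral>\<^sup>+ x. ennreal (\<bar>v x\<bar> powr p) \<partial>lebesgue) < \<infinity>
     \<and> (\<integral>\<^sup>+ x. (\<integral>\<^sup>+ y. ennreal (\<bar>v x - v y\<bar> powr p / norm (x - y) powr (real DIM('a) + s * p))
            \<partial>lebesgue) \<partial>lebesgue) < \<infinity>"

definition Wsp0 :: "real \<Rightarrow> real \<Rightarrow> 'a::euclidean_space set \<Rightarrow> ('a \<Rightarrow> real) \<Rightarrow> bool" where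
  "Wsp0 s p \<Omega> v \<longleftrightarrow> Wsp s p v \<and> (AE x in lebesgue. x \<notin> \<Omega> \<longrightarrow> v x = 0)"

definition admissible_kernel :: "real \<Rightarrow> real \<Rightarrow> real \<Rightarrow> real \<Rightarrow> ('a::euclidean_space \<Rightarrow> 'a \<Rightarrow> real) \<Rightarrow> bool" where
  "admissible_kernel s p lam Lam K \<longleftrightarrow>
     (\<lambda>(x, y). K x y) \<in> borel_measurable (lebesgue :: ('a \<times> 'a) measure)
     \<and> (\<forall>x y. 0 \<le> K x y) \<and> (\<forall>x y. K x y = K y x)
     \<and> (AE z in (lebesgue :: ('a \<times> 'a) measure).
          lam \<le> K (fst z) (snd z) * norm (fst z - snd z) powr (real DIM('a) + s * p)
          \<and> K (fst z) (snd z) * norm (fst z - snd z) powr (real DIM('a) + s * p) \<le> Lam)"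

definition Kminus :: "real \<Rightarrow> real \<Rightarrow> 'a::euclidean_space set \<Rightarrow> ('a \<Rightarrow> real) \<Rightarrow> ('a \<Rightarrow> real) \<Rightarrow> bool" where
  "Kminus s p \<Omega> g v \<longleftrightarrow> Wsp s p v \<and> Wsp0 s p \<Omega> (\<lambda>x. max (- (g x - v x)) 0)"

definition energy_form :: "real \<Rightarrow> ('a::euclidean_space \<Rightarrow> 'a \<Rightarrow> real) \<Rightarrow> ('a \<Rightarrow> real) \<Rightarrow> ('a \<Rightarrow> real) \<Rightarrow> ('a \<times> 'a \<Rightarrow> real)" where
  "energy_form p K u \<eta> = (\<lambda>(x, y). K x y * \<bar>u x - u y\<bar> powr (p - 2) * (u x - u y) * (\<eta> x - \<eta> y))"

definition weak_subsolution :: "real \<Rightarrow> real \<Rightarrow> ('a::euclidean_space \<Rightarrow> 'a \<Rightarrow> real) \<Rightarrow> 'a set \<Rightarrow> ('a \<Rightarrow> real) \<Rightarrow> ('a \<Rightarrow> real) \<Rightarrow> bool" where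
  "weak_subsolution s p K \<Omega> g u \<longleftrightarrow> Kminus s p \<Omega> g u \<and>
     (\<forall>\<eta>. Wsp0 s p \<Omega> \<eta> \<and> (AE x in lebesgue. 0 \<le> \<eta> x) \<longrightarrow>
        integrable (lebesgue :: ('a \<times> 'a) measure) (energy_form p K u \<eta>)
        \<and> integral\<^sup>L (lebesgue :: ('a \<times> 'a) measure) (energy_form p K u \<eta>) \<le> 0)"

definition Tail :: "real \<Rightarrow> real \<Rightarrow> ('a::euclidean_space \<Rightarrow> real) \<Rightarrow> 'a \<Rightarrow> real \<Rightarrow> real" where
  "Tail s p v x0 R = (R powr (s * p) *
     (\<integral>x \<in> - ball x0 R. \<bar>v x\<bar> powr (p - 1) / norm (x - x0) powr (real DIM('a) + s * p) \<partial>lebesgue))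
       powr (1 / (p - 1))"

end

theory Submission
  imports Defs
begin

text \<open>De Giorgi iteration on the truncations \<open>w = max (u - k) 0\<close>. Testing the equation with
  \<open>w * \<phi> powr p\<close> for a Lipschitz cutoff \<open>\<phi>\<close> gives a Caccioppoli inequality for \<open>w * \<phi>\<close> whose only
  nonlocal error term is controlled by the tail. In place of a Sobolev inequality the iteration uses
  a fractional Faber-Krahn inequality
  \<open>\<integral>|v|^p \<le> C * |{v \<noteq> 0}|^(s p / n) * [v]^p\<close>,
  which is elementary and holds whether \<open>s p\<close> is smaller or larger than \<open>n\<close>; combined with
  Chebyshev's inequality for \<open>{u > k}\<close> it yields a recursion with gain \<open>s p / n\<close>, and this gain is
  what produces the exponent of \<open>\<delta>\<close>.\<close>

section \<open>Pointwise inequalities for truncations\<close>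

text \<open>The tail enters the iteration as one number \<tau>, a bound for the integral over the
  complement of \<open>ball x0 (r / 2)\<close> that serves every step. Requiring
  \<open>\<delta> * Tail \<le> k\<close> of the final level k allows \<tau> to be a multiple of (k /
  \<delta>)^(p-1). Divided by the (p-1)-th power of a level gap, which is a fraction of k, it loses
  its k and leaves the cost \<delta>^(-(p-1)). With \<beta> = s p / n, one step multiplies the
  excess A by about r^(-s p) \<delta>^(-(p-1)) (A / k^p)^\<beta>. Making this small means k^p ~
  \<delta>^(-(p-1)/\<beta>) A / r^n, and the p-th root gives the stated power of \<delta>.

  Measurability shapes the rest. The function u is only Lebesgue measurable, and Lebesgue measure on
  pairs is not the product of the completed factors. So u is replaced by a Borel representative f,
  and the estimates are made with iterated \<open>ennreal\<close> integrals over
  \<open>lborel\<close>. Finiteness has to be proved for the test function and for the return to the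
  Bochner integrals of the statement.\<close>

lemma powr_add_le:
  fixes a b p :: real
  assumes "0 \<le> a" "0 \<le> b" "0 \<le> p"
  shows "(a + b) powr p \<le> 2 powr p * (a powr p + b powr p)"
proof -
  have "(a + b) powr p \<le> (2 * max a b) powr p"
    using assms by (intro powr_mono2) auto
  also have "\<dots> = 2 powr p * max a b powr p"
    by (simp add: powr_mult)
  also have "max a b powr p \<le> a powr p + b powr p"
    by (auto simp: max_def)
  finally show ?thesis
    by simp
qed

text \<open>Mean value theorem. The case a = 0 is split off because the derivative rule is applied
  at the left endpoint too, where it needs a positive base.\<close>

lemma powr_diff_le:
  fixes a b p :: real
  assumes "0 \<le> a" "a \<le> b" "1 \<le> p"
  shows "b powr p - a powr p \<le> p * b powr (p - 1) * (b - a)"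
proof (cases "a = 0")
  case True
  have "b powr p \<le> p * b powr p"
    using assms by (simp add: mult_le_cancel_right1)
  moreover have "b powr (p - 1) * b = b powr p"
    using assms by (cases "b = 0") (auto simp: powr_diff)
  ultimately show ?thesis
    using assms by (simp only: True mult.assoc) simp
next
  case False
  then have a: "0 < a"
    using assms by simp
  show ?thesis
  proof (cases "a = b")
    case False
    then have ab: "a < b"
      using assms by simp
    have "\<exists>z>a. z < b \<and> b powr p - a powr p = (b - a) * (p * z powr (p - 1))"
      by (rule MVT2[OF ab]) (use a in \<open>auto intro!: derivative_eq_intros simp: powr_diff\<close>)
    then obtain z where z: "a < z" "z < b" "b powr p - a powr p = (b - a) * (p * z powr (p - 1))"
      by auto
    have "z powr (p - 1) \<le> b powr (p - 1)"
      using z a assms by (intro powr_mono2) auto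
    then have "(b - a) * (p * z powr (p - 1)) \<le> (b - a) * (p * b powr (p - 1))"
      using ab assms by (intro mult_left_mono) auto
    then show ?thesis
      unfolding z(3) by (simp only: mult_ac)
  qed simp
qed

text \<open>True at 0 because \<open>0 powr x = 0\<close> for every x. Hence it may also be read
  with p - 1 for p, turning |t|^(p-2) t into t^(p-1) for t >= 0 even when p - 2 is negative.\<close>

lemma powr_minus_one_mult:
  fixes a p :: real
  assumes "0 \<le> a"
  shows "a powr (p - 1) * a = a powr p"
  using assms by (cases "a = 0") (auto simp: powr_diff)

text \<open>A dichotomy replaces conjugate exponents: if \<open>2 * p * Y \<le> X\<close>, the
  product is already at most half of X^p; otherwise X is less than 2 p Y and can be
  eliminated.\<close>

lemma young_absorb:
  fixes X Y p :: real
  assumes "0 \<le> X" "0 \<le> Y" "1 \<le> p"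
  shows "p * X powr (p - 1) * Y \<le> X powr p / 2 + p * (2 * p) powr (p - 1) * Y powr p"
proof (cases "2 * p * Y \<le> X")
  case True
  have "p * X powr (p - 1) * Y = X powr (p - 1) * (2 * p * Y) / 2"
    by simp
  also have "\<dots> \<le> X powr (p - 1) * X / 2"
    using True by (intro divide_right_mono mult_left_mono) auto
  also have "\<dots> = X powr p / 2"
    using assms by (simp add: powr_minus_one_mult)
  also have "\<dots> \<le> X powr p / 2 + p * (2 * p) powr (p - 1) * Y powr p"
    using assms by simp
  finally show ?thesis .
next
  case False
  have "p * X powr (p - 1) * Y \<le> p * (2 * p * Y) powr (p - 1) * Y"
    using False assms by (intro mult_right_mono mult_left_mono powr_mono2) auto
  also have "\<dots> = p * (2 * p) powr (p - 1) * (Y powr (p - 1) * Y)"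
    using assms by (simp add: powr_mult mult_ac)
  also have "\<dots> = p * (2 * p) powr (p - 1) * Y powr p"
    using assms by (simp add: powr_minus_one_mult)
  also have "\<dots> \<le> X powr p / 2 + p * (2 * p) powr (p - 1) * Y powr p"
    by simp
  finally show ?thesis .
qed

text \<open>The second summand is the constant of \<open>young_absorb\<close>. The extra 1 pays for
  the error made when the truncation difference times the larger cutoff value is exchanged for the
  difference of the products.\<close>

definition caccioppoli_const :: "real \<Rightarrow> real" where
  "caccioppoli_const p = 1 + p * (2 * p) powr (p - 1)"

lemma caccioppoli_const_ge_1: "0 \<le> p \<Longrightarrow> 1 \<le> caccioppoli_const p"
  by (simp add: caccioppoli_const_def)

text \<open>Ordering a and b fixes the sign of a - b, so that only the larger truncation w appears
  in the error. The proof works with the truncation difference D: first a - b is replaced by D, then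
  the variation of the cutoff is absorbed into half of (D M)^p.\<close>

lemma truncation_pointwise_ordered:
  fixes a b k p \<phi> \<psi> :: real
  assumes p: "1 < p" and ab: "b \<le> a" and \<phi>: "0 \<le> \<phi>" "0 \<le> \<psi>"
  defines "w \<equiv> max (a - k) 0" and "z \<equiv> max (b - k) 0"
  shows "2 powr (- p - 1) * \<bar>w * \<phi> - z * \<psi>\<bar> powr p - caccioppoli_const p * (w * \<bar>\<phi> - \<psi>\<bar>) powr p
     \<le> \<bar>a - b\<bar> powr (p - 2) * (a - b) * (w * \<phi> powr p - z * \<psi> powr p)"
proof -
  define D where "D = w - z"
  define M where "M = max \<phi> \<psi>"
  have D: "0 \<le> D" "D \<le> w" "0 \<le> z" "0 \<le> w" "D \<le> a - b"
    using ab by (auto simp: D_def w_def z_def)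
  have J: "\<bar>a - b\<bar> powr (p - 2) * (a - b) = (a - b) powr (p - 1)"
    using ab powr_minus_one_mult[of "a - b" "p - 1"] by simp
  \<comment> \<open>The common factor may be negative, so monotonicity alone does not suffice. If b
    > k then D equals a - b; otherwise z = 0 and the factor is nonnegative.\<close>
  have 1: "D powr (p - 1) * (w * \<phi> powr p - z * \<psi> powr p)
      \<le> (a - b) powr (p - 1) * (w * \<phi> powr p - z * \<psi> powr p)"
  proof (cases "b > k")
    case True
    then have "D = a - b"
      using ab by (auto simp: D_def w_def z_def)
    then show ?thesis by simp
  next
    case False
    then have z0: "z = 0"
      by (simp add: z_def)
    have "D powr (p - 1) \<le> (a - b) powr (p - 1)"
      using D p by (intro powr_mono2) auto
    then show ?thesis
      using D by (simp add: z0 mult_right_mono)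
  qed
  \<comment> \<open>If \<psi> <= \<phi>, the larger value carries the larger cutoff and there is no
    loss. Otherwise w (\<psi>^p - \<phi>^p) is lost; after \<open>powr_diff_le\<close> the loss fits
    \<open>young_absorb\<close> with X = D \<psi> and Y = w (\<psi> - \<phi>).\<close>
  have 2: "(D * M) powr p / 2 - p * (2 * p) powr (p - 1) * (w * \<bar>\<phi> - \<psi>\<bar>) powr p
      \<le> D powr (p - 1) * (w * \<phi> powr p - z * \<psi> powr p)"
  proof (cases "\<psi> \<le> \<phi>")
    case True
    have "(D * M) powr p / 2 \<le> D powr p * \<phi> powr p"
      using D \<phi> True by (simp add: M_def powr_mult)
    also have "\<dots> = D powr (p - 1) * (D * \<phi> powr p)"
      using D by (simp add: powr_minus_one_mult flip: mult.assoc)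
    also have "\<dots> \<le> D powr (p - 1) * (w * \<phi> powr p - z * \<psi> powr p)"
    proof (intro mult_left_mono)
      have "z * \<psi> powr p \<le> z * \<phi> powr p"
        using D True \<phi> p by (intro mult_left_mono powr_mono2) auto
      then show "D * \<phi> powr p \<le> w * \<phi> powr p - z * \<psi> powr p"
        by (simp add: D_def left_diff_distrib)
    qed simp
    also have "(D * M) powr p / 2 - p * (2 * p) powr (p - 1) * (w * \<bar>\<phi> - \<psi>\<bar>) powr p \<le> (D * M) powr p / 2"
      using p by simp
    finally (xtrans) show ?thesis .
  next
    case False
    then have M: "M = \<psi>"
      by (simp add: M_def)
    have "w * (\<psi> powr p - \<phi> powr p) \<le> w * (p * \<psi> powr (p - 1) * (\<psi> - \<phi>))"
      using D False \<phi> p by (intro mult_left_mono powr_diff_le) auto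
    then have "D powr (p - 1) * (D * \<psi> powr p - w * (p * \<psi> powr (p - 1) * (\<psi> - \<phi>)))
       \<le> D powr (p - 1) * (D * \<psi> powr p - w * (\<psi> powr p - \<phi> powr p))"
      by (intro mult_left_mono) auto
    also have "\<dots> = D powr (p - 1) * (w * \<phi> powr p - z * \<psi> powr p)"
      by (simp add: D_def algebra_simps)
    also have "D powr (p - 1) * (D * \<psi> powr p - w * (p * \<psi> powr (p - 1) * (\<psi> - \<phi>)))
      = (D * \<psi>) powr p - p * (D * \<psi>) powr (p - 1) * (w * (\<psi> - \<phi>))"
    proof -
      have eq: "(D * \<psi>) powr p = D powr (p - 1) * (D * \<psi> powr p)"
        by (simp only: powr_mult mult.assoc flip: powr_minus_one_mult[OF D(1), of p])
      show ?thesis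
        by (simp only: eq powr_mult[of D \<psi> "p - 1"] right_diff_distrib[of "D powr (p - 1)"] mult_ac)
    qed
    finally have *: "(D * \<psi>) powr p - p * (D * \<psi>) powr (p - 1) * (w * (\<psi> - \<phi>))
       \<le> D powr (p - 1) * (w * \<phi> powr p - z * \<psi> powr p)" .
    have "p * (D * \<psi>) powr (p - 1) * (w * (\<psi> - \<phi>))
       \<le> (D * \<psi>) powr p / 2 + p * (2 * p) powr (p - 1) * (w * (\<psi> - \<phi>)) powr p"
      using D False \<phi> p by (intro young_absorb) auto
    with * False show ?thesis
      by (simp add: M)
  qed
  have "\<bar>w * \<phi> - z * \<psi>\<bar> \<le> D * M + w * \<bar>\<phi> - \<psi>\<bar>"
  proof -
    have "w * \<phi> - z * \<psi> = D * \<psi> + w * (\<phi> - \<psi>)"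
      by (simp add: D_def algebra_simps)
    also have "\<bar>\<dots>\<bar> \<le> D * \<psi> + w * \<bar>\<phi> - \<psi>\<bar>"
      using D \<phi> abs_triangle_ineq[of "D * \<psi>" "w * (\<phi> - \<psi>)"] by (simp add: abs_mult)
    also have "D * \<psi> \<le> D * M"
      using D by (intro mult_left_mono) (auto simp: M_def)
    finally show ?thesis by simp
  qed
  then have "\<bar>w * \<phi> - z * \<psi>\<bar> powr p \<le> (D * M + w * \<bar>\<phi> - \<psi>\<bar>) powr p"
    using p by (intro powr_mono2) auto
  also have "\<dots> \<le> 2 powr p * ((D * M) powr p + (w * \<bar>\<phi> - \<psi>\<bar>) powr p)"
    using D \<phi> p by (intro powr_add_le) (auto simp: M_def)
  \<comment> \<open>The factor 2^(-p-1) turns the 2^p of \<open>powr_add_le\<close> into 1/2, the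
    share of (D M)^p that survived the absorption.\<close>
  finally have "2 powr (- p - 1) * \<bar>w * \<phi> - z * \<psi>\<bar> powr p \<le>
      2 powr (- p - 1) * (2 powr p * ((D * M) powr p + (w * \<bar>\<phi> - \<psi>\<bar>) powr p))"
    by (intro mult_left_mono) auto
  also have "\<dots> = (D * M) powr p / 2 + (w * \<bar>\<phi> - \<psi>\<bar>) powr p / 2"
    by (simp add: powr_diff powr_minus field_simps)
  finally have 3: "2 powr (- p - 1) * \<bar>w * \<phi> - z * \<psi>\<bar> powr p \<le> (D * M) powr p / 2 + (w * \<bar>\<phi> - \<psi>\<bar>) powr p / 2" .
  have combine: "A - (1 + c) * X \<le> R" if "A \<le> B / 2 + X / 2" "B / 2 - c * X \<le> L" "L \<le> R" "0 \<le> X"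
    for A B X L R c :: real
    using that unfolding distrib_right by linarith
  show ?thesis
    unfolding J caccioppoli_const_def by (rule combine[OF 3 2 1 powr_ge_zero])
qed

text \<open>Exchanging the two points reverses the sign of both factors on the right, so the ordered
  case covers everything. The symmetric error w^p + z^p replaces the power of the larger
  truncation.\<close>

lemma truncation_pointwise:
  fixes a b k p \<phi> \<psi> :: real
  assumes p: "1 < p" and \<phi>: "0 \<le> \<phi>" "0 \<le> \<psi>"
  defines "w \<equiv> max (a - k) 0" and "z \<equiv> max (b - k) 0"
  shows "2 powr (- p - 1) * \<bar>w * \<phi> - z * \<psi>\<bar> powr p
        - caccioppoli_const p * (w powr p + z powr p) * \<bar>\<phi> - \<psi>\<bar> powr p
     \<le> \<bar>a - b\<bar> powr (p - 2) * (a - b) * (w * \<phi> powr p - z * \<psi> powr p)"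
proof -
  have C: "0 \<le> caccioppoli_const p"
    using caccioppoli_const_ge_1[of p] p by simp
  have wz: "0 \<le> w" "0 \<le> z"
    by (auto simp: w_def z_def)
  show ?thesis
  proof (cases "b \<le> a")
    case True
    have "caccioppoli_const p * (w * \<bar>\<phi> - \<psi>\<bar>) powr p
      \<le> caccioppoli_const p * (w powr p + z powr p) * \<bar>\<phi> - \<psi>\<bar> powr p"
      using C wz by (simp add: powr_mult mult.assoc mult_left_mono mult_right_mono)
    then have "2 powr (- p - 1) * \<bar>w * \<phi> - z * \<psi>\<bar> powr p
        - caccioppoli_const p * (w powr p + z powr p) * \<bar>\<phi> - \<psi>\<bar> powr p
      \<le> 2 powr (- p - 1) * \<bar>w * \<phi> - z * \<psi>\<bar> powr p - caccioppoli_const p * (w * \<bar>\<phi> - \<psi>\<bar>) powr p"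
      by (rule diff_left_mono)
    also have "\<dots> \<le> \<bar>a - b\<bar> powr (p - 2) * (a - b) * (w * \<phi> powr p - z * \<psi> powr p)"
      using truncation_pointwise_ordered[OF p True \<phi>, of k] unfolding w_def z_def .
    finally show ?thesis .
  next
    case False
    have "2 powr (- p - 1) * \<bar>w * \<phi> - z * \<psi>\<bar> powr p
        - caccioppoli_const p * (w powr p + z powr p) * \<bar>\<phi> - \<psi>\<bar> powr p
      \<le> 2 powr (- p - 1) * \<bar>z * \<psi> - w * \<phi>\<bar> powr p - caccioppoli_const p * (z * \<bar>\<psi> - \<phi>\<bar>) powr p"
      unfolding abs_minus_commute[of "z * \<psi>"] abs_minus_commute[of \<psi>]
      using C wz by (simp add: powr_mult mult.assoc mult_left_mono mult_right_mono)
    also have "\<dots> \<le> \<bar>b - a\<bar> powr (p - 2) * (b - a) * (z * \<psi> powr p - w * \<phi> powr p)"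
      using truncation_pointwise_ordered[OF p _ \<phi>(2,1), of a b k] False unfolding w_def z_def by simp
    also have "\<dots> = \<bar>a - b\<bar> powr (p - 2) * (a - b) * (w * \<phi> powr p - z * \<psi> powr p)"
      unfolding abs_minus_commute[of b] by (simp add: algebra_simps)
    finally show ?thesis .
  qed
qed

text \<open>The case in which the second point lies where the cutoff vanishes. Here z^p must not
  occur, since far away only the tail power p - 1 is under control. If w > 0 and b > a, then b - a
  <= z, which bounds the negative part. The first two terms have a nonpositive sum and are kept to
  match the shape of \<open>truncation_pointwise\<close>.\<close>

lemma truncation_pointwise_tail:
  fixes a b k p \<phi> :: real
  assumes p: "1 < p" and \<phi>: "0 \<le> \<phi>"
  defines "w \<equiv> max (a - k) 0" and "z \<equiv> max (b - k) 0"
  shows "2 powr (- p - 1) * \<bar>w * \<phi>\<bar> powr p - caccioppoli_const p * w powr p * \<phi> powr p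
        - z powr (p - 1) * (w * \<phi> powr p)
     \<le> \<bar>a - b\<bar> powr (p - 2) * (a - b) * (w * \<phi> powr p)"
proof -
  have "2 powr (- p - 1) \<le> caccioppoli_const p"
    using caccioppoli_const_ge_1[of p] p powr_mono[of "- p - 1" 0 2] by simp
  then have "2 powr (- p - 1) * \<bar>w * \<phi>\<bar> powr p \<le> caccioppoli_const p * (w powr p * \<phi> powr p)"
    using \<phi> by (auto simp: w_def abs_mult powr_mult intro!: mult_right_mono)
  moreover have "- (z powr (p - 1)) * (w * \<phi> powr p) \<le> \<bar>a - b\<bar> powr (p - 2) * (a - b) * (w * \<phi> powr p)"
  proof (cases "w = 0")
    case False
    then have a: "k < a"
      by (auto simp: w_def)
    have "- (z powr (p - 1)) \<le> \<bar>a - b\<bar> powr (p - 2) * (a - b)"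
    proof (cases "b \<le> a")
      case True
      then have "0 \<le> \<bar>a - b\<bar> powr (p - 2) * (a - b)"
        by simp
      moreover have "- (z powr (p - 1)) \<le> 0"
        by simp
      ultimately show ?thesis
        by (rule order_trans[rotated])
    next
      case False
      then have "\<bar>a - b\<bar> powr (p - 2) * (b - a) = (b - a) powr (p - 1)"
        using powr_minus_one_mult[of "b - a" "p - 1"] by (simp add: abs_minus_commute)
      also have "\<dots> \<le> z powr (p - 1)"
        using False a p by (intro powr_mono2) (auto simp: z_def)
      finally show ?thesis
        by (simp add: algebra_simps)
    qed
    then show ?thesis
      by (intro mult_right_mono) (auto simp: w_def)
  qed simp
  ultimately show ?thesis
    by (simp add: mult.assoc)
qed

section \<open>The fractional kernel\<close>

lemma dyadic_shell:
  fixes t :: real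
  assumes "1 \<le> t"
  obtains k :: nat where "2 ^ k \<le> t" "t \<le> 2 ^ Suc k"
proof -
  define n where "n = (LEAST n. t < 2 ^ n)"
  obtain m where "t < 2 ^ m"
    using real_arch_pow[of 2 t] by auto
  then have n: "t < 2 ^ n"
    unfolding n_def by (rule LeastI)
  then have "n \<noteq> 0"
    using assms by (intro notI) simp
  then obtain k where k: "n = Suc k"
    by (cases n) auto
  have "\<not> t < 2 ^ k"
    using not_less_Least[of k "\<lambda>n. t < 2 ^ n"] k unfolding n_def by simp
  then show ?thesis
    using n that[of k] k by simp
qed

text \<open>On the diagonal the value is 0, because \<open>0 powr e = 0\<close> and
  \<open>1 / 0 = 0\<close>. The applications take a = s p.\<close>

definition frac_kernel :: "real \<Rightarrow> 'a::euclidean_space \<Rightarrow> 'a \<Rightarrow> real" where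
  "frac_kernel a x y = 1 / norm (x - y) powr (real DIM('a) + a)"

lemma frac_kernel_nonneg [simp]: "0 \<le> frac_kernel a x y"
  by (simp add: frac_kernel_def)

lemma frac_kernel_commute: "frac_kernel a x y = frac_kernel a y x"
  by (simp add: frac_kernel_def norm_minus_commute)

lemma borel_measurable_frac_kernel [measurable (raw)]:
  fixes f g :: "'b \<Rightarrow> 'a::euclidean_space"
  assumes [measurable]: "f \<in> borel_measurable M" "g \<in> borel_measurable M"
  shows "(\<lambda>x. frac_kernel a (f x) (g x)) \<in> borel_measurable M"
  unfolding frac_kernel_def by measurable

lemma frac_kernel_le:
  fixes x y :: "'a::euclidean_space"
  assumes "0 < r" "r \<le> norm (x - y)" "0 \<le> a"
  shows "frac_kernel a x y \<le> r powr - (real DIM('a) + a)"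
proof -
  have "r powr (real DIM('a) + a) \<le> norm (x - y) powr (real DIM('a) + a)"
    using assms by (intro powr_mono2) auto
  moreover have "0 < norm (x - y)"
    using assms by linarith
  ultimately show ?thesis
    using assms unfolding frac_kernel_def powr_minus_divide
    by (intro divide_left_mono) auto
qed

text \<open>Integrates the p-th power of the difference of a cutoff with Lipschitz constant 1/d.
  Dyadic shells around x give two geometric series: outside radius d the ratio is 2^(-a), summable
  as a > 0; inside, |x - y|^p compensates the singularity and the ratio is 2^(a-p), summable as a <
  p.\<close>

lemma frac_kernel_cutoff_integrable:
  fixes a p :: real
  assumes a: "0 < a" "a < p"
  obtains C where "0 < C" "\<And>(x :: 'a::euclidean_space) d. 0 < d \<Longrightarrow>
    (\<integral>\<^sup>+ y. ennreal (min 1 (norm (x - y) / d) powr p * frac_kernel a x y) \<partial>lborel) \<le> ennreal (C * d powr - a)"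
proof -
  define n where "n = real DIM('a)"
  define \<omega> where "\<omega> = unit_ball_vol n"
  have \<omega>: "0 < \<omega>"
    unfolding \<omega>_def n_def by simp
  define C where "C = \<omega> * 2 powr n * (1 / (1 - 2 powr - a)) + \<omega> * 2 powr (n + a) * (1 / (1 - 2 powr (a - p)))"
  have small: "2 powr - a < (1::real)" "2 powr (a - p) < (1::real)"
    using a powr_less_mono[of "- a" 0 2] powr_less_mono[of "a - p" 0 2] by auto
  have "0 < C"
    unfolding C_def using \<omega> small by (intro add_pos_pos mult_pos_pos) auto
  moreover have "(\<integral>\<^sup>+ y. ennreal (min 1 (norm (x - y) / d) powr p * frac_kernel a x y) \<partial>lborel) \<le> ennreal (C * d powr - a)"
    if d: "0 < d" for x :: 'a and d
  proof -
    \<comment> \<open>On each shell the kernel is taken at the inner radius and the factor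
      \<open>min 1 (norm (x - y) / d) powr p\<close> at the outer one. Each shell is then enlarged
      to the full outer ball, which changes only the constant.\<close>
    define c1 R1 where "c1 k = (d * 2 ^ k) powr - (n + a)" and "R1 k = d * 2 ^ Suc k" for k :: nat
    define c2 R2 where "c2 k = (2 powr - real k) powr p * (d * 2 powr - real (Suc k)) powr - (n + a)" and "R2 k = d * 2 powr - real k"
      for k :: nat
    define F1 F2 where "F1 y = (\<Sum>k. ennreal (c1 k) * indicator (cball x (R1 k)) y)"
      and "F2 y = (\<Sum>k. ennreal (c2 k) * indicator (cball x (R2 k)) y)" for y
    have [measurable]: "cball x R \<in> sets borel" for R
      by (simp add: borel_closed)
    have one_term: "ennreal c \<le> (\<Sum>k. ennreal (h k) * indicator (A k) y)"
      if "c \<le> h k" "y \<in> A k" for c k and h :: "nat \<Rightarrow> real" and A and y :: 'a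
    proof -
      have "ennreal c \<le> (\<Sum>k\<in>{k}. ennreal (h k) * indicator (A k) y)"
        using that by (simp add: ennreal_leI)
      also have "\<dots> \<le> (\<Sum>k. ennreal (h k) * indicator (A k) y)"
        by (intro sum_le_suminf summableI) auto
      finally show ?thesis .
    qed
    have bound: "ennreal (min 1 (norm (x - y) / d) powr p * frac_kernel a x y) \<le> F1 y + F2 y" for y
    proof (cases "norm (x - y) \<ge> d")
      case True
      then have "1 \<le> norm (x - y) / d"
        using d by simp
      then obtain k where k: "2 ^ k \<le> norm (x - y) / d" "norm (x - y) / d \<le> 2 ^ Suc k"
        by (rule dyadic_shell)
      have "min 1 (norm (x - y) / d) powr p * frac_kernel a x y \<le> 1 * c1 k"
        unfolding c1_def n_def using k d a True
        by (intro mult_mono frac_kernel_le powr_le1) (auto simp: field_simps)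
      moreover have "y \<in> cball x (R1 k)"
        using k d by (simp add: R1_def dist_norm field_simps)
      ultimately have "ennreal (min 1 (norm (x - y) / d) powr p * frac_kernel a x y) \<le> F1 y"
        unfolding F1_def by (intro one_term) auto
      then show ?thesis
        by (rule order_trans) simp
    next
      case False
      show ?thesis
      proof (cases "x = y")
        case xy: False
        then have t: "0 < norm (x - y)"
          by simp
        then have "1 \<le> d / norm (x - y)"
          using False by simp
        then obtain k where k: "2 ^ k \<le> d / norm (x - y)" "d / norm (x - y) \<le> 2 ^ Suc k"
          by (rule dyadic_shell)
        have k': "norm (x - y) \<le> d * 2 powr - real k" "d * 2 powr - real (Suc k) \<le> norm (x - y)"
          using k t d unfolding powr_minus_divide powr_realpow[OF zero_less_numeral]
          by (auto simp: pos_le_divide_eq pos_divide_le_eq mult.commute simp del: power_Suc)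
        have "min 1 (norm (x - y) / d) powr p * frac_kernel a x y \<le> c2 k"
          unfolding c2_def n_def using k' d a False
          by (intro mult_mono frac_kernel_le powr_mono2) (auto simp: field_simps)
        moreover have "y \<in> cball x (R2 k)"
          using k' by (simp add: R2_def dist_norm)
        ultimately have "ennreal (min 1 (norm (x - y) / d) powr p * frac_kernel a x y) \<le> F2 y"
          unfolding F2_def by (intro one_term) auto
        then show ?thesis
          by (rule order_trans) simp
      qed (use a in simp)
    qed
    have em: "emeasure lborel (cball x R) = ennreal (\<omega> * R powr n)" if "0 < R" for R
      using emeasure_cball[of R x] that by (simp add: \<omega>_def n_def powr_realpow)
    have 1: "(\<integral>\<^sup>+ y. F1 y \<partial>lborel) = ennreal (\<omega> * 2 powr n * d powr - a * (1 / (1 - 2 powr - a)))"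
    proof -
      have "(\<integral>\<^sup>+ y. F1 y \<partial>lborel) = (\<Sum>k. \<integral>\<^sup>+ y. ennreal (c1 k) * indicator (cball x (R1 k)) y \<partial>lborel)"
        unfolding F1_def by (intro nn_integral_suminf) measurable
      also have "\<dots> = (\<Sum>k. ennreal (\<omega> * 2 powr n * d powr - a * (2 powr - a) ^ k))"
      proof (intro suminf_cong)
        fix k
        have "c1 k = d powr - (n + a) * 2 powr (- real k * (n + a))"
          unfolding c1_def powr_mult
          by (simp only: powr_realpow[symmetric] zero_less_numeral powr_powr minus_mult_minus mult_minus_left mult_minus_right)
        moreover have "R1 k powr n = d powr n * 2 powr (real (Suc k) * n)"
          unfolding R1_def powr_mult by (simp only: powr_powr powr_realpow[symmetric, of 2 "Suc k"] zero_less_numeral)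
        ultimately have "c1 k * (\<omega> * R1 k powr n)
          = \<omega> * (d powr - (n + a) * d powr n) * (2 powr (- real k * (n + a)) * 2 powr (real (Suc k) * n))"
          by (simp only: mult_ac)
        also have "d powr - (n + a) * d powr n = d powr - a"
          by (simp flip: powr_add)
        also have "2 powr (- real k * (n + a)) * 2 powr (real (Suc k) * n) = (2::real) powr n * 2 powr (- a * real k)"
          by (simp add: algebra_simps flip: powr_add)
        also have "(2::real) powr (- a * real k) = (2 powr - a) ^ k"
          by (simp add: powr_powr powr_realpow[symmetric])
        finally have "c1 k * (\<omega> * R1 k powr n) = \<omega> * 2 powr n * d powr - a * (2 powr - a) ^ k"
          by (simp only: mult_ac)
        then show "(\<integral>\<^sup>+ y. ennreal (c1 k) * indicator (cball x (R1 k)) y \<partial>lborel)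
          = ennreal (\<omega> * 2 powr n * d powr - a * (2 powr - a) ^ k)"
          using d \<omega> by (subst nn_integral_cmult_indicator) (auto simp: em R1_def c1_def simp flip: ennreal_mult)
      qed
      also have "\<dots> = ennreal (\<omega> * 2 powr n * d powr - a * (1 / (1 - 2 powr - a)))"
        using \<omega> small by (intro suminf_ennreal_eq sums_mult geometric_sums) auto
      finally show ?thesis .
    qed
    have 2: "(\<integral>\<^sup>+ y. F2 y \<partial>lborel) = ennreal (\<omega> * 2 powr (n + a) * d powr - a * (1 / (1 - 2 powr (a - p))))"
    proof -
      have "(\<integral>\<^sup>+ y. F2 y \<partial>lborel) = (\<Sum>k. \<integral>\<^sup>+ y. ennreal (c2 k) * indicator (cball x (R2 k)) y \<partial>lborel)"
        unfolding F2_def by (intro nn_integral_suminf) measurable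
      also have "\<dots> = (\<Sum>k. ennreal (\<omega> * 2 powr (n + a) * d powr - a * (2 powr (a - p)) ^ k))"
      proof (intro suminf_cong)
        fix k
        have "(d * 2 powr - real (Suc k)) powr - (n + a) = d powr - (n + a) * 2 powr (real (Suc k) * (n + a))"
          unfolding powr_mult powr_powr by (simp only: minus_mult_minus)
        moreover have "R2 k powr n = d powr n * 2 powr (- real k * n)"
          by (simp add: R2_def powr_mult powr_powr)
        ultimately have "c2 k * (\<omega> * R2 k powr n)
          = \<omega> * (d powr - (n + a) * d powr n) * (2 powr (- real k * p) * 2 powr (real (Suc k) * (n + a)) * 2 powr (- real k * n))"
          unfolding c2_def by (simp only: powr_powr mult_ac)
        also have "d powr - (n + a) * d powr n = d powr - a"
          by (simp flip: powr_add)
        also have "2 powr (- real k * p) * 2 powr (real (Suc k) * (n + a)) * 2 powr (- real k * n)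
          = (2::real) powr (n + a) * 2 powr ((a - p) * real k)"
          by (simp add: algebra_simps flip: powr_add)
        also have "(2::real) powr ((a - p) * real k) = (2 powr (a - p)) ^ k"
          by (simp add: powr_powr powr_realpow[symmetric])
        finally have "c2 k * (\<omega> * R2 k powr n) = \<omega> * 2 powr (n + a) * d powr - a * (2 powr (a - p)) ^ k"
          by (simp only: mult_ac)
        then show "(\<integral>\<^sup>+ y. ennreal (c2 k) * indicator (cball x (R2 k)) y \<partial>lborel)
          = ennreal (\<omega> * 2 powr (n + a) * d powr - a * (2 powr (a - p)) ^ k)"
          using d \<omega> by (subst nn_integral_cmult_indicator) (auto simp: em R2_def c2_def simp flip: ennreal_mult)
      qed
      also have "\<dots> = ennreal (\<omega> * 2 powr (n + a) * d powr - a * (1 / (1 - 2 powr (a - p))))"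
        using \<omega> small by (intro suminf_ennreal_eq sums_mult geometric_sums) auto
      finally show ?thesis .
    qed
    have "(\<integral>\<^sup>+ y. ennreal (min 1 (norm (x - y) / d) powr p * frac_kernel a x y) \<partial>lborel)
      \<le> (\<integral>\<^sup>+ y. F1 y + F2 y \<partial>lborel)"
      by (intro nn_integral_mono bound)
    also have "\<dots> = (\<integral>\<^sup>+ y. F1 y \<partial>lborel) + (\<integral>\<^sup>+ y. F2 y \<partial>lborel)"
      unfolding F1_def F2_def by (intro nn_integral_add) measurable
    also have "\<dots> = ennreal (C * d powr - a)"
      unfolding 1 2 C_def using \<omega> small by (subst ennreal_plus[symmetric]) (auto simp: algebra_simps)
    finally show ?thesis .
  qed
  ultimately show ?thesis
    by (rule that)
qed

text \<open>The p-th power of the Gagliardo seminorm. Being \<open>ennreal\<close>-valued over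
  \<open>lborel\<close>, it allows Tonelli for Borel v and carries no finiteness side
  conditions.\<close>

definition gagliardo :: "real \<Rightarrow> real \<Rightarrow> ('a::euclidean_space \<Rightarrow> real) \<Rightarrow> ennreal" where
  "gagliardo s p v = (\<integral>\<^sup>+ x. \<integral>\<^sup>+ y. ennreal (\<bar>v x - v y\<bar> powr p * frac_kernel (s * p) x y) \<partial>lborel \<partial>lborel)"

text \<open>A ball of measure \<open>2 * m\<close> centred at a point of the support leaves measure at least \<open>m\<close>
  on which \<open>v\<close> vanishes, and there the kernel is bounded below.\<close>

lemma fractional_faber_krahn:
  fixes s p :: real
  assumes s: "0 < s" "1 < p"
  obtains C where "0 < C" "\<And>(v :: 'a::euclidean_space \<Rightarrow> real) m. v \<in> borel_measurable borel \<Longrightarrow> 0 < m \<Longrightarrow>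
    emeasure lborel {x. v x \<noteq> 0} \<le> ennreal m \<Longrightarrow>
    (\<integral>\<^sup>+ x. ennreal (\<bar>v x\<bar> powr p) \<partial>lborel) \<le> ennreal (C * m powr (s * p / real DIM('a))) * gagliardo s p v"
proof -
  define n where "n = real DIM('a)"
  have n: "0 < n"
    by (simp add: n_def)
  define \<omega> where "\<omega> = unit_ball_vol n"
  have \<omega>: "0 < \<omega>"
    unfolding \<omega>_def n_def by simp
  define C where "C = (2 / \<omega>) powr ((n + s * p) / n)"
  have "0 < C"
    using \<omega> by (simp add: C_def)
  moreover have "(\<integral>\<^sup>+ x. ennreal (\<bar>v x\<bar> powr p) \<partial>lborel) \<le> ennreal (C * m powr (s * p / n)) * gagliardo s p v"
    if [measurable]: "v \<in> borel_measurable borel" and m: "0 < m" "emeasure lborel {x. v x \<noteq> 0} \<le> ennreal m"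
    for v :: "'a \<Rightarrow> real" and m
  proof -
    define S where "S = {x. v x \<noteq> 0}"
    have [measurable]: "S \<in> sets borel"
      unfolding S_def by measurable
    \<comment> \<open>The radius at which a ball has measure 2 m. The constant C was chosen so that
      R^(n + s p) / m = C m^(s p / n): the reciprocal lower kernel bound divided by the measure of
      the vanishing set.\<close>
    define R where "R = (2 * m / \<omega>) powr (1 / n)"
    have R: "0 < R" "\<omega> * R powr n = 2 * m" "R powr (n + s * p) / m = C * m powr (s * p / n)"
    proof -
      show "0 < R" "\<omega> * R powr n = 2 * m"
        using m \<omega> n by (auto simp: R_def powr_powr)
      have "R powr (n + s * p) = (2 * m / \<omega>) powr ((n + s * p) / n)"
        by (simp add: R_def powr_powr)
      also have "\<dots> = (2 / \<omega> * m) powr ((n + s * p) / n)"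
        by simp
      also have "\<dots> = C * m powr ((n + s * p) / n)"
        by (simp only: C_def powr_mult)
      also have "(n + s * p) / n = 1 + s * p / n"
        using n by (simp add: field_simps)
      finally show "R powr (n + s * p) / m = C * m powr (s * p / n)"
        using m by (simp add: powr_add)
    qed
    have inner: "ennreal (\<bar>v x\<bar> powr p) \<le> ennreal (C * m powr (s * p / n)) *
        (\<integral>\<^sup>+ y. ennreal (\<bar>v x - v y\<bar> powr p * frac_kernel (s * p) x y) \<partial>lborel)" for x
    proof (cases "x \<in> S")
      case False
      then show ?thesis
        using s by (simp add: S_def)
    next
      case True
      have "emeasure lborel (ball x R) \<le> emeasure lborel (ball x R - S) + emeasure lborel S"
        by (rule order_trans[OF emeasure_mono emeasure_subadditive]) auto
      also have "emeasure lborel (ball x R) = ennreal m + ennreal m"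
        using R m emeasure_ball[of R x] by (simp add: \<omega>_def n_def powr_realpow flip: ennreal_plus)
      also have "emeasure lborel S \<le> ennreal m"
        using m by (simp add: S_def)
      finally have big: "ennreal m \<le> emeasure lborel (ball x R - S)"
        using ennreal_add_left_cancel_le by (simp add: add_left_mono add.commute)
      have "ennreal (\<bar>v x\<bar> powr p * R powr - (n + s * p)) * ennreal m
         \<le> ennreal (\<bar>v x\<bar> powr p * R powr - (n + s * p)) * emeasure lborel (ball x R - S)"
        by (intro mult_left_mono big) auto
      also have "\<dots> = (\<integral>\<^sup>+ y. ennreal (\<bar>v x\<bar> powr p * R powr - (n + s * p)) * indicator (ball x R - S) y \<partial>lborel)"
        by (subst nn_integral_cmult_indicator) auto
      also have "\<dots> \<le> (\<integral>\<^sup>+ y. ennreal (\<bar>v x - v y\<bar> powr p * frac_kernel (s * p) x y) \<partial>lborel)"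
      proof (intro nn_integral_mono)
        fix y
        show "ennreal (\<bar>v x\<bar> powr p * R powr - (n + s * p)) * indicator (ball x R - S) y
          \<le> ennreal (\<bar>v x - v y\<bar> powr p * frac_kernel (s * p) x y)"
        proof (cases "y \<in> ball x R - S")
          case y: True
          then have "0 < norm (x - y)" "norm (x - y) \<le> R" "v y = 0"
            using True by (auto simp: S_def dist_norm)
          then have "R powr - (n + s * p) \<le> frac_kernel (s * p) x y"
            unfolding frac_kernel_def powr_minus_divide n_def using R s
            by (intro divide_left_mono powr_mono2) auto
          then show ?thesis
            using y \<open>v y = 0\<close> by (simp add: ennreal_leI mult_left_mono)
        qed simp
      qed
      finally have *: "ennreal (\<bar>v x\<bar> powr p * R powr - (n + s * p) * m)
         \<le> (\<integral>\<^sup>+ y. ennreal (\<bar>v x - v y\<bar> powr p * frac_kernel (s * p) x y) \<partial>lborel)"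
        using m by (simp add: ennreal_mult)
      have "\<bar>v x\<bar> powr p = C * m powr (s * p / n) * (\<bar>v x\<bar> powr p * R powr - (n + s * p) * m)"
        unfolding R(3)[symmetric] powr_minus using R(1) m by simp
      then have "ennreal (\<bar>v x\<bar> powr p) = ennreal (C * m powr (s * p / n)) * ennreal (\<bar>v x\<bar> powr p * R powr - (n + s * p) * m)"
        using \<open>0 < C\<close> m by (simp flip: ennreal_mult)
      then show ?thesis
        using * by (simp add: mult_left_mono)
    qed
    have "(\<integral>\<^sup>+ x. ennreal (\<bar>v x\<bar> powr p) \<partial>lborel) \<le> (\<integral>\<^sup>+ x. ennreal (C * m powr (s * p / n)) *
        (\<integral>\<^sup>+ y. ennreal (\<bar>v x - v y\<bar> powr p * frac_kernel (s * p) x y) \<partial>lborel) \<partial>lborel)"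
      by (intro nn_integral_mono inner)
    also have "\<dots> = ennreal (C * m powr (s * p / n)) * gagliardo s p v"
      unfolding gagliardo_def by (intro nn_integral_cmult) measurable
    finally show ?thesis .
  qed
  ultimately show ?thesis
    by (intro that[of C]) (auto simp: n_def)
qed

section \<open>Cutoffs and test functions\<close>

definition cutoff :: "'a::euclidean_space \<Rightarrow> real \<Rightarrow> real \<Rightarrow> 'a \<Rightarrow> real" where
  "cutoff x0 \<sigma> d x = max 0 (min 1 ((\<sigma> - norm (x - x0)) / d))"

lemma cutoff_bounds [simp]: "0 \<le> cutoff x0 \<sigma> d x" "cutoff x0 \<sigma> d x \<le> 1"
  by (auto simp: cutoff_def)

lemma cutoff_eq_0: "0 < d \<Longrightarrow> \<sigma> \<le> norm (x - x0) \<Longrightarrow> cutoff x0 \<sigma> d x = 0"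
  using divide_nonpos_pos[of "\<sigma> - norm (x - x0)" d] by (simp add: cutoff_def)

lemma cutoff_eq_1: "0 < d \<Longrightarrow> norm (x - x0) \<le> \<sigma> - d \<Longrightarrow> cutoff x0 \<sigma> d x = 1"
  by (simp add: cutoff_def max_def min_def field_simps)

lemma cutoff_diff_le:
  assumes "0 < d"
  shows "\<bar>cutoff x0 \<sigma> d x - cutoff x0 \<sigma> d y\<bar> \<le> min 1 (norm (x - y) / d)"
proof -
  have "\<bar>cutoff x0 \<sigma> d x - cutoff x0 \<sigma> d y\<bar> \<le> \<bar>(\<sigma> - norm (x - x0)) / d - (\<sigma> - norm (y - x0)) / d\<bar>"
    unfolding cutoff_def by (auto simp: max_def min_def)
  also have "\<dots> = \<bar>norm (y - x0) - norm (x - x0)\<bar> / d"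
    using assms by (simp add: diff_divide_distrib[symmetric] abs_divide)
  also have "\<dots> \<le> norm ((y - x0) - (x - x0)) / d"
    using assms by (intro divide_right_mono norm_triangle_ineq3) auto
  finally have "\<bar>cutoff x0 \<sigma> d x - cutoff x0 \<sigma> d y\<bar> \<le> norm (x - y) / d"
    by (simp add: norm_minus_commute)
  moreover have "\<bar>cutoff x0 \<sigma> d x - cutoff x0 \<sigma> d y\<bar> \<le> 1"
    using cutoff_bounds[of x0 \<sigma> d x] cutoff_bounds[of x0 \<sigma> d y] by linarith
  ultimately show ?thesis
    by simp
qed

lemma borel_measurable_cutoff [measurable]: "cutoff x0 \<sigma> d \<in> borel_measurable borel"
  unfolding cutoff_def by measurable

text \<open>Completion does not change nonnegative integrals, so for a Borel representative
  membership can be checked over \<open>lborel\<close>.\<close>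

lemma Wsp_borel_iff:
  fixes v :: "'a::euclidean_space \<Rightarrow> real"
  assumes [measurable]: "v \<in> borel_measurable borel"
  shows "Wsp s p v \<longleftrightarrow> (\<integral>\<^sup>+ x. ennreal (\<bar>v x\<bar> powr p) \<partial>lborel) < \<infinity> \<and> gagliardo s p v < \<infinity>"
proof -
  have "v \<in> borel_measurable lebesgue"
    by (rule measurable_completion) simp
  then show ?thesis
    unfolding Wsp_def gagliardo_def frac_kernel_def nn_integral_completion by simp
qed

text \<open>The iterated form of the seminorm makes this a matter of one variable at a time: for a
  good x the inner integrands agree at almost every y, and almost every x is good.\<close>

lemma Wsp_cong_AE:
  fixes u v :: "'a::euclidean_space \<Rightarrow> real"
  assumes W: "Wsp s p u" and ae: "AE x in lebesgue. u x = v x" and v: "v \<in> borel_measurable lebesgue"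
  shows "Wsp s p v"
proof -
  have "(\<integral>\<^sup>+ x. ennreal (\<bar>v x\<bar> powr p) \<partial>lebesgue) = (\<integral>\<^sup>+ x. ennreal (\<bar>u x\<bar> powr p) \<partial>lebesgue)"
    using ae by (intro nn_integral_cong_AE) auto
  moreover have "(\<integral>\<^sup>+ x. (\<integral>\<^sup>+ y. ennreal (\<bar>v x - v y\<bar> powr p / norm (x - y) powr (real DIM('a) + s * p)) \<partial>lebesgue) \<partial>lebesgue)
    = (\<integral>\<^sup>+ x. (\<integral>\<^sup>+ y. ennreal (\<bar>u x - u y\<bar> powr p / norm (x - y) powr (real DIM('a) + s * p)) \<partial>lebesgue) \<partial>lebesgue)"
  proof (rule nn_integral_cong_AE)
    show "AE x in lebesgue. (\<integral>\<^sup>+ y. ennreal (\<bar>v x - v y\<bar> powr p / norm (x - y) powr (real DIM('a) + s * p)) \<partial>lebesgue)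
      = (\<integral>\<^sup>+ y. ennreal (\<bar>u x - u y\<bar> powr p / norm (x - y) powr (real DIM('a) + s * p)) \<partial>lebesgue)"
      using ae
    proof (rule AE_mp, intro AE_I2 impI)
      fix x assume "u x = v x"
      then show "(\<integral>\<^sup>+ y. ennreal (\<bar>v x - v y\<bar> powr p / norm (x - y) powr (real DIM('a) + s * p)) \<partial>lebesgue)
        = (\<integral>\<^sup>+ y. ennreal (\<bar>u x - u y\<bar> powr p / norm (x - y) powr (real DIM('a) + s * p)) \<partial>lebesgue)"
        using ae by (intro nn_integral_cong_AE) auto
    qed
  qed
  ultimately show ?thesis
    using W v unfolding Wsp_def by simp
qed

lemma powr_diff_unit_le:
  fixes a b p :: real
  assumes "0 \<le> a" "a \<le> 1" "0 \<le> b" "b \<le> 1" "1 \<le> p"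
  shows "\<bar>a powr p - b powr p\<bar> \<le> p * \<bar>a - b\<bar>"
proof -
  have *: "\<bar>y powr p - x powr p\<bar> \<le> p * \<bar>y - x\<bar>" if "0 \<le> x" "x \<le> y" "y \<le> 1" for x y :: real
  proof -
    have "y powr p - x powr p \<le> p * y powr (p - 1) * (y - x)"
      using that assms by (intro powr_diff_le) auto
    also have "\<dots> \<le> p * 1 * (y - x)"
      using that assms by (intro mult_right_mono mult_left_mono powr_le1) auto
    finally have "y powr p - x powr p \<le> p * (y - x)"
      by simp
    moreover have "x powr p \<le> y powr p"
      using that assms by (intro powr_mono2) auto
    ultimately show ?thesis
      using that by simp
  qed
  show ?thesis
    using *[of a b] *[of b a] assms by (cases "a \<le> b") (simp_all add: abs_minus_commute)
qed

text \<open>Admissibility of the test function. The product rule leaves one part bounded by the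
  seminorm of f and one where the cutoff difference is integrated in y first, leaving the integral
  of |f|^p. The assumption k >= 0 gives w <= |f|, and s < 1 gives s p < p for the kernel
  bound.\<close>

lemma Wsp_truncated_cutoff:
  fixes f :: "'a::euclidean_space \<Rightarrow> real"
  assumes sp: "0 < s" "s < 1" "1 < p" and [measurable]: "f \<in> borel_measurable borel"
    and W: "Wsp s p f" and k: "0 \<le> k" and d: "0 < d"
  shows "Wsp s p (\<lambda>x. max (f x - k) 0 * cutoff x0 \<sigma> d x powr p)"
proof -
  define \<phi> where "\<phi> = cutoff x0 \<sigma> d"
  define w where "w x = max (f x - k) 0" for x
  have [measurable]: "\<phi> \<in> borel_measurable borel" "w \<in> borel_measurable borel"
    unfolding \<phi>_def w_def by measurable
  have \<phi>: "0 \<le> \<phi> x" "\<phi> x \<le> 1" for x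
    by (simp_all add: \<phi>_def)
  have \<phi>p: "\<phi> x powr p \<le> 1" for x
    using \<phi> sp by (intro powr_le1) auto
  have w: "0 \<le> w x" "w x \<le> \<bar>f x\<bar>" "\<bar>w x - w y\<bar> \<le> \<bar>f x - f y\<bar>" for x y
    using k by (auto simp: w_def)
  have W': "(\<integral>\<^sup>+ x. ennreal (\<bar>f x\<bar> powr p) \<partial>lborel) < \<infinity>" "gagliardo s p f < \<infinity>"
    using W Wsp_borel_iff[of f] by auto
  have sp': "0 < s * p" "s * p < p"
    using sp by simp_all
  obtain C where C: "0 < C" "\<And>(x :: 'a) d. 0 < d \<Longrightarrow>
    (\<integral>\<^sup>+ y. ennreal (min 1 (norm (x - y) / d) powr p * frac_kernel (s * p) x y) \<partial>lborel) \<le> ennreal (C * d powr - (s * p))"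
    by (rule frac_kernel_cutoff_integrable[OF sp', where 'a = 'a]) (rule that)
  \<comment> \<open>2^p comes from splitting the sum of two terms, p^p from the Lipschitz constant p
    of t^p on [0,1].\<close>
  define c where "c = 2 powr p * p powr p"
  have "0 < c"
    using sp by (simp add: c_def)
  have "(\<integral>\<^sup>+ x. ennreal (\<bar>w x * \<phi> x powr p\<bar> powr p) \<partial>lborel) \<le> (\<integral>\<^sup>+ x. ennreal (\<bar>f x\<bar> powr p) \<partial>lborel)"
  proof (intro nn_integral_mono ennreal_leI powr_mono2)
    fix x
    have "w x * \<phi> x powr p \<le> \<bar>f x\<bar> * 1"
      using w \<phi>p by (intro mult_mono) auto
    then show "\<bar>w x * \<phi> x powr p\<bar> \<le> \<bar>f x\<bar>"
      using w[of x] by (simp add: abs_mult)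
  qed (use sp in auto)
  then have 1: "(\<integral>\<^sup>+ x. ennreal (\<bar>w x * \<phi> x powr p\<bar> powr p) \<partial>lborel) < \<infinity>"
    using W'(1) by (rule le_less_trans)
  have pw: "\<bar>w x * \<phi> x powr p - w y * \<phi> y powr p\<bar> powr p * frac_kernel (s * p) x y
      \<le> 2 powr p * (\<bar>f x - f y\<bar> powr p * frac_kernel (s * p) x y)
        + c * \<bar>f x\<bar> powr p * (min 1 (norm (x - y) / d) powr p * frac_kernel (s * p) x y)" for x y
  proof -
    have "w x * \<phi> x powr p - w y * \<phi> y powr p = \<phi> y powr p * (w x - w y) + w x * (\<phi> x powr p - \<phi> y powr p)"
      by (simp add: algebra_simps)
    also have "\<bar>\<dots>\<bar> \<le> \<bar>\<phi> y powr p * (w x - w y)\<bar> + \<bar>w x * (\<phi> x powr p - \<phi> y powr p)\<bar>"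
      by (rule abs_triangle_ineq)
    also have "\<bar>\<phi> y powr p * (w x - w y)\<bar> \<le> 1 * \<bar>f x - f y\<bar>"
      unfolding abs_mult using w \<phi>p by (intro mult_mono) auto
    also have "\<bar>w x * (\<phi> x powr p - \<phi> y powr p)\<bar> \<le> \<bar>f x\<bar> * (p * min 1 (norm (x - y) / d))"
    proof -
      have "\<bar>\<phi> x powr p - \<phi> y powr p\<bar> \<le> p * \<bar>\<phi> x - \<phi> y\<bar>"
        using \<phi> sp by (intro powr_diff_unit_le) auto
      also have "\<dots> \<le> p * min 1 (norm (x - y) / d)"
        unfolding \<phi>_def using sp d by (intro mult_left_mono cutoff_diff_le) auto
      finally show ?thesis
        unfolding abs_mult using w by (intro mult_mono) auto
    qed
    finally have "\<bar>w x * \<phi> x powr p - w y * \<phi> y powr p\<bar> \<le> \<bar>f x - f y\<bar> + \<bar>f x\<bar> * (p * min 1 (norm (x - y) / d))"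
      by simp
    then have "\<bar>w x * \<phi> x powr p - w y * \<phi> y powr p\<bar> powr p
      \<le> (\<bar>f x - f y\<bar> + \<bar>f x\<bar> * (p * min 1 (norm (x - y) / d))) powr p"
      using sp by (intro powr_mono2) auto
    also have "\<dots> \<le> 2 powr p * (\<bar>f x - f y\<bar> powr p + (\<bar>f x\<bar> * (p * min 1 (norm (x - y) / d))) powr p)"
      using sp d by (intro powr_add_le) auto
    also have "\<dots> = 2 powr p * \<bar>f x - f y\<bar> powr p + c * \<bar>f x\<bar> powr p * min 1 (norm (x - y) / d) powr p"
      unfolding powr_mult c_def by (simp only: distrib_left mult_ac)
    finally have "\<bar>w x * \<phi> x powr p - w y * \<phi> y powr p\<bar> powr p * frac_kernel (s * p) x y
      \<le> (2 powr p * \<bar>f x - f y\<bar> powr p + c * \<bar>f x\<bar> powr p * min 1 (norm (x - y) / d) powr p) * frac_kernel (s * p) x y"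
      by (rule mult_right_mono) simp
    then show ?thesis
      by (simp only: distrib_right mult.assoc)
  qed
  have "gagliardo s p (\<lambda>x. w x * \<phi> x powr p) \<le> (\<integral>\<^sup>+ x. ennreal (2 powr p) * (\<integral>\<^sup>+ y. ennreal (\<bar>f x - f y\<bar> powr p * frac_kernel (s * p) x y) \<partial>lborel)
     + ennreal (c * C * d powr - (s * p)) * ennreal (\<bar>f x\<bar> powr p) \<partial>lborel)"
    unfolding gagliardo_def
  proof (intro nn_integral_mono)
    fix x :: 'a
    have "(\<integral>\<^sup>+ y. ennreal (\<bar>w x * \<phi> x powr p - w y * \<phi> y powr p\<bar> powr p * frac_kernel (s * p) x y) \<partial>lborel)
      \<le> (\<integral>\<^sup>+ y. ennreal (2 powr p) * ennreal (\<bar>f x - f y\<bar> powr p * frac_kernel (s * p) x y)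
         + ennreal (c * \<bar>f x\<bar> powr p) * ennreal (min 1 (norm (x - y) / d) powr p * frac_kernel (s * p) x y) \<partial>lborel)"
    proof (intro nn_integral_mono)
      fix y
      show "ennreal (\<bar>w x * \<phi> x powr p - w y * \<phi> y powr p\<bar> powr p * frac_kernel (s * p) x y)
        \<le> ennreal (2 powr p) * ennreal (\<bar>f x - f y\<bar> powr p * frac_kernel (s * p) x y)
         + ennreal (c * \<bar>f x\<bar> powr p) * ennreal (min 1 (norm (x - y) / d) powr p * frac_kernel (s * p) x y)"
        using ennreal_leI[OF pw[of x y]] \<open>0 < c\<close> by (simp add: ennreal_mult)
    qed
    also have "\<dots> = ennreal (2 powr p) * (\<integral>\<^sup>+ y. ennreal (\<bar>f x - f y\<bar> powr p * frac_kernel (s * p) x y) \<partial>lborel)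
        + ennreal (c * \<bar>f x\<bar> powr p) * (\<integral>\<^sup>+ y. ennreal (min 1 (norm (x - y) / d) powr p * frac_kernel (s * p) x y) \<partial>lborel)"
      by (subst nn_integral_add) (auto simp: nn_integral_cmult)
    also have "\<dots> \<le> ennreal (2 powr p) * (\<integral>\<^sup>+ y. ennreal (\<bar>f x - f y\<bar> powr p * frac_kernel (s * p) x y) \<partial>lborel)
        + ennreal (c * \<bar>f x\<bar> powr p) * ennreal (C * d powr - (s * p))"
      by (intro add_left_mono mult_left_mono C d) auto
    also have "ennreal (c * \<bar>f x\<bar> powr p) * ennreal (C * d powr - (s * p)) = ennreal (c * C * d powr - (s * p)) * ennreal (\<bar>f x\<bar> powr p)"
      using \<open>0 < c\<close> C by (simp add: mult_ac flip: ennreal_mult)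
    finally show "(\<integral>\<^sup>+ y. ennreal (\<bar>w x * \<phi> x powr p - w y * \<phi> y powr p\<bar> powr p * frac_kernel (s * p) x y) \<partial>lborel)
      \<le> ennreal (2 powr p) * (\<integral>\<^sup>+ y. ennreal (\<bar>f x - f y\<bar> powr p * frac_kernel (s * p) x y) \<partial>lborel)
        + ennreal (c * C * d powr - (s * p)) * ennreal (\<bar>f x\<bar> powr p)" .
  qed
  also have "\<dots> = ennreal (2 powr p) * gagliardo s p f + ennreal (c * C * d powr - (s * p)) * (\<integral>\<^sup>+ x. ennreal (\<bar>f x\<bar> powr p) \<partial>lborel)"
    unfolding gagliardo_def by (subst nn_integral_add) (auto simp: nn_integral_cmult)
  also have "\<dots> < \<infinity>"
    using W' by (simp add: ennreal_mult_less_top)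
  finally have "gagliardo s p (\<lambda>x. w x * \<phi> x powr p) < \<infinity>" .
  then show ?thesis
    using 1 by (simp add: Wsp_borel_iff flip: w_def \<phi>_def)
qed

text \<open>Passes from the signed Bochner integral of the weak formulation to
  \<open>ennreal\<close> estimates without knowing that the error H is integrable: if its integral
  is infinite nothing is claimed, and otherwise F + H dominates G.\<close>

lemma nn_integral_le_of_integral_nonpos:
  fixes F G H :: "'b \<Rightarrow> real"
  assumes F: "integrable M F" "integral\<^sup>L M F \<le> 0"
    and [measurable]: "G \<in> borel_measurable M" "H \<in> borel_measurable M"
    and nonneg: "\<And>x. 0 \<le> G x" "\<And>x. 0 \<le> H x"
    and le: "AE x in M. G x \<le> F x + H x"
  shows "(\<integral>\<^sup>+ x. ennreal (G x) \<partial>M) \<le> (\<integral>\<^sup>+ x. ennreal (H x) \<partial>M)"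
proof (cases "(\<integral>\<^sup>+ x. ennreal (H x) \<partial>M) = \<infinity>")
  case False
  then have H: "integrable M H"
    using nonneg by (intro integrableI_nonneg) (auto simp: top.not_eq_extremum)
  have FH: "integrable M (\<lambda>x. F x + H x)"
    using F H by simp
  have G: "integrable M G"
    by (rule Bochner_Integration.integrable_bound[OF FH]) (use le nonneg in \<open>auto elim!: eventually_mono intro: order_trans\<close>)
  have "integral\<^sup>L M G \<le> integral\<^sup>L M (\<lambda>x. F x + H x)"
    using G FH le by (rule integral_mono_AE)
  also have "\<dots> \<le> integral\<^sup>L M H"
    using F H by simp
  finally show ?thesis
    using G H nonneg by (simp add: nn_integral_eq_integral ennreal_leI)
qed simp

section \<open>The Caccioppoli inequality\<close>

text \<open>The exceptional set need not be Borel, so it is enclosed in a Borel null set N first. On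
  \<open>lborel\<close>, unlike on its completion, the measure on pairs is the product measure, and
  both N-cylinders are null there.\<close>

lemma AE_lebesgue_pair:
  fixes u f :: "'a::euclidean_space \<Rightarrow> real"
  assumes "AE x in lebesgue. u x = f x"
  shows "AE z in (lebesgue :: ('a \<times> 'a) measure). u (fst z) = f (fst z) \<and> u (snd z) = f (snd z)"
proof -
  have "AE x in lborel. u x = f x"
    using assms by (simp add: AE_completion_iff)
  then obtain N where N: "{x. u x \<noteq> f x} \<subseteq> N" "N \<in> null_sets lborel"
    by (auto simp: eventually_ae_filter)
  have [measurable]: "N \<in> sets borel"
    using N(2) by (auto simp: null_sets_def)
  have "AE x in lborel. x \<notin> N"
    using N(2) by (rule AE_not_in)
  have 1: "AE z in (lborel :: 'a measure) \<Otimes>\<^sub>M (lborel :: 'a measure). fst z \<notin> N"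
  proof (rule lborel_pair.AE_pair_measure)
    show "AE x in (lborel :: 'a measure). AE y in (lborel :: 'a measure). fst (x, y) \<notin> N"
      using \<open>AE x in lborel. x \<notin> N\<close> by auto
  qed measurable
  have 2: "AE z in (lborel :: 'a measure) \<Otimes>\<^sub>M (lborel :: 'a measure). snd z \<notin> N"
  proof (rule lborel_pair.AE_pair_measure)
    show "AE x in (lborel :: 'a measure). AE y in (lborel :: 'a measure). snd (x, y) \<notin> N"
      using \<open>AE x in lborel. x \<notin> N\<close> by auto
  qed measurable
  have "AE z in (lborel :: ('a \<times> 'a) measure). u (fst z) = f (fst z) \<and> u (snd z) = f (snd z)"
    using 1 2 unfolding lborel_prod by eventually_elim (use N(1) in auto)
  then show ?thesis
    by (rule AE_completion)
qed

lemma nn_integral_lebesgue_pair: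
  fixes h :: "'a::euclidean_space \<Rightarrow> 'a \<Rightarrow> ennreal"
  assumes "(\<lambda>(x, y). h x y) \<in> borel_measurable (lborel \<Otimes>\<^sub>M lborel)"
  shows "(\<integral>\<^sup>+ z. h (fst z) (snd z) \<partial>lebesgue) = (\<integral>\<^sup>+ x. \<integral>\<^sup>+ y. h x y \<partial>lborel \<partial>lborel)"
  using lborel.nn_integral_fst[OF assms] unfolding nn_integral_completion lborel_prod
  by (simp add: split_beta')

text \<open>Recentres the kernel so that the double integral over near and far points splits into a
  product. With t = |y - x0| >= \<sigma> + d one has d t <= (\<sigma> + d) (t - \<sigma>), and t -
  \<sigma> <= |x - y|.\<close>

lemma frac_kernel_offcentre:
  fixes x y x0 :: "'a::euclidean_space"
  assumes "0 < \<sigma>" "0 < d" "0 \<le> a" "norm (x - x0) < \<sigma>" "\<sigma> + d \<le> norm (y - x0)"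
  shows "frac_kernel a x y \<le> ((\<sigma> + d) / d) powr (real DIM('a) + a) * frac_kernel a x0 y"
proof -
  define t where "t = norm (y - x0)"
  have tr: "t - \<sigma> \<le> norm (x - y)"
    using norm_triangle_ineq[of "y - x" "x - x0"] assms by (simp add: t_def norm_minus_commute)
  have "0 \<le> \<sigma> * (t - (\<sigma> + d))"
    using assms by (simp add: t_def)
  then have "d * t \<le> (\<sigma> + d) * (t - \<sigma>)"
    by (simp add: algebra_simps)
  also have "\<dots> \<le> (\<sigma> + d) * norm (x - y)"
    using tr assms by (intro mult_left_mono) auto
  finally have "t \<le> (\<sigma> + d) / d * norm (x - y)"
    using assms by (simp add: field_simps)
  then have "t powr (real DIM('a) + a) \<le> ((\<sigma> + d) / d * norm (x - y)) powr (real DIM('a) + a)"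
    using assms by (intro powr_mono2) (auto simp: t_def)
  also have "\<dots> = ((\<sigma> + d) / d) powr (real DIM('a) + a) * norm (x - y) powr (real DIM('a) + a)"
    by (rule powr_mult)
  finally have *: "t powr (real DIM('a) + a) \<le> ((\<sigma> + d) / d) powr (real DIM('a) + a) * norm (x - y) powr (real DIM('a) + a)" .
  have pos: "0 < t" "0 < norm (x - y)"
    using assms tr by (auto simp: t_def)
  then have "0 < t powr (real DIM('a) + a)" "0 < norm (x - y) powr (real DIM('a) + a)"
    by simp_all
  then show ?thesis
    using * unfolding frac_kernel_def norm_minus_commute[of x0] t_def[symmetric]
    by (simp add: field_simps)
qed

text \<open>The cutoff is supported in radius \<sigma>, and the gap d up to the ball B of radius
  \<sigma> + d keeps the kernel between the support and the far region nonsingular. Pairs with a far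
  point then contribute the integral of w over B times a tail centred at x0. The constant is
  obtained before K, \<Omega> and the functions are introduced, which records what it depends
  on.\<close>

lemma caccioppoli:
  fixes s p lam Lam :: real
  assumes sp: "0 < s" "s < 1" "1 < p" and lam: "1 \<le> lam" "lam \<le> Lam"
  obtains C where "0 < C" "\<And>(K :: 'a::euclidean_space \<Rightarrow> 'a \<Rightarrow> real) \<Omega> g u f k x0 \<sigma> d.
    admissible_kernel s p lam Lam K \<Longrightarrow> weak_subsolution s p K \<Omega> g u \<Longrightarrow>
    f \<in> borel_measurable borel \<Longrightarrow> AE x in lebesgue. u x = f x \<Longrightarrow> 0 \<le> k \<Longrightarrow> 0 < d \<Longrightarrow> 0 < \<sigma> \<Longrightarrow>
    ball x0 (\<sigma> + d) \<subseteq> \<Omega> \<Longrightarrow>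
    gagliardo s p (\<lambda>x. max (f x - k) 0 * cutoff x0 \<sigma> d x)
      \<le> ennreal C * (ennreal (d powr - (s * p)) * (\<integral>\<^sup>+ x. ennreal (max (f x - k) 0 powr p) * indicator (ball x0 (\<sigma> + d)) x \<partial>lborel)
        + ennreal (((\<sigma> + d) / d) powr (real DIM('a) + s * p))
          * (\<integral>\<^sup>+ x. ennreal (max (f x - k) 0) * indicator (ball x0 (\<sigma> + d)) x \<partial>lborel)
          * (\<integral>\<^sup>+ y. ennreal (max (f y - k) 0 powr (p - 1) * frac_kernel (s * p) x0 y) * indicator (- ball x0 (\<sigma> + d)) y \<partial>lborel))"
proof -
  have sp': "0 < s * p" "s * p < p"
    using sp by simp_all
  obtain C1 where C1: "0 < C1" "\<And>(x :: 'a) d. 0 < d \<Longrightarrow>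
    (\<integral>\<^sup>+ y. ennreal (min 1 (norm (x - y) / d) powr p * frac_kernel (s * p) x y) \<partial>lborel) \<le> ennreal (C1 * d powr - (s * p))"
    by (rule frac_kernel_cutoff_integrable[OF sp', where 'a = 'a]) (rule that)
  define P where "P = caccioppoli_const p"
  have P: "1 \<le> P"
    using sp caccioppoli_const_ge_1[of p] by (simp add: P_def)
  define c where "c = lam * 2 powr (- p - 1)"
  have c: "0 < c"
    using lam by (simp add: c_def)
  \<comment> \<open>1/c undoes the coercivity constant, 2 Lam comes from the upper kernel bound and
    the symmetrization, and the maximum dominates the coefficients of both error terms.\<close>
  define C where "C = 1 / c * (2 * Lam) * max (P * C1) 1"
  have "0 < C"
    using c lam by (simp add: C_def)
  show ?thesis
  proof (rule that[OF \<open>0 < C\<close>])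
    fix K :: "'a \<Rightarrow> 'a \<Rightarrow> real" and \<Omega> :: "'a set" and g u f :: "'a \<Rightarrow> real" and k \<sigma> d :: real and x0 :: 'a
    assume K: "admissible_kernel s p lam Lam K" and u: "weak_subsolution s p K \<Omega> g u"
      and [measurable]: "f \<in> borel_measurable borel" and ae: "AE x in lebesgue. u x = f x"
      and k: "0 \<le> k" and d: "0 < d" and \<sigma>: "0 < \<sigma>" and sub: "ball x0 (\<sigma> + d) \<subseteq> \<Omega>"
    define B where "B = ball x0 (\<sigma> + d)"
    define \<phi> where "\<phi> = cutoff x0 \<sigma> d"
    define w where "w x = max (f x - k) 0" for x
    define \<eta> where "\<eta> x = w x * \<phi> x powr p" for x
    have [measurable]: "\<phi> \<in> borel_measurable borel" "w \<in> borel_measurable borel" "\<eta> \<in> borel_measurable borel" "B \<in> sets borel"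
      unfolding \<phi>_def w_def \<eta>_def B_def by measurable
    have \<phi>: "0 \<le> \<phi> x" "\<phi> x \<le> 1" "\<phi> x powr p \<le> 1" for x
      using sp by (auto simp: \<phi>_def intro!: powr_le1)
    have w: "0 \<le> w x" for x
      by (simp add: w_def)
    have \<phi>_supp: "norm (x - x0) < \<sigma>" if "\<phi> x \<noteq> 0" for x
      using cutoff_eq_0[OF d, of \<sigma> x x0] that by (force simp: \<phi>_def)
    have \<phi>_out: "\<phi> x = 0" if "x \<notin> B" for x
      using \<phi>_supp[of x] that d by (force simp: B_def dist_norm norm_minus_commute)
    have W: "Wsp s p f"
    proof (rule Wsp_cong_AE[OF _ ae])
      show "Wsp s p u"
        using u by (simp add: weak_subsolution_def Kminus_def)
      show "f \<in> borel_measurable lebesgue"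
        by (rule measurable_completion) simp
    qed
    have "Wsp s p \<eta>"
      unfolding \<eta>_def w_def \<phi>_def by (rule Wsp_truncated_cutoff) (use sp W k d in auto)
    moreover have "\<eta> x = 0" if "x \<notin> \<Omega>" for x
      using that sub \<phi>_out[of x] sp unfolding B_def[symmetric] by (auto simp: \<eta>_def)
    ultimately have "Wsp0 s p \<Omega> \<eta>"
      unfolding Wsp0_def by simp
    moreover have "0 \<le> \<eta> x" for x
      using w \<phi> by (simp add: \<eta>_def)
    ultimately have F: "integrable lebesgue (energy_form p K u \<eta>)" "integral\<^sup>L lebesgue (energy_form p K u \<eta>) \<le> 0"
      using u by (simp_all add: weak_subsolution_def)
    \<comment> \<open>One half of a symmetric error: \<open>E x y + E y x\<close> covers all
      positions of the pair. The first summand is localized in x alone, so it also serves when y is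
      outside B; the second is the tail interaction.\<close>
    define E where "E x y = P * (w x powr p * indicator B x) * \<bar>\<phi> x - \<phi> y\<bar> powr p
      + (w y powr (p - 1) * indicator (- B) y) * (w x * \<phi> x powr p)" for x y
    have E: "0 \<le> E x y" for x y
      using P w by (simp add: E_def)
    have pw: "2 powr (- p - 1) * \<bar>w x * \<phi> x - w y * \<phi> y\<bar> powr p - (E x y + E y x)
      \<le> \<bar>f x - f y\<bar> powr (p - 2) * (f x - f y) * (\<eta> x - \<eta> y)" for x y
    proof -
      consider "x \<in> B" "y \<in> B" | "x \<in> B" "y \<notin> B" | "x \<notin> B" "y \<in> B" | "x \<notin> B" "y \<notin> B"
        by blast
      then show ?thesis
      proof cases
        case 1
        then show ?thesis
          using truncation_pointwise[OF sp(3) \<phi>(1) \<phi>(1), of "f x" k x "f y" y]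
          by (simp add: E_def \<eta>_def w_def P_def abs_minus_commute[of "\<phi> y"] distrib_left distrib_right)
      next
        case 2
        then show ?thesis
          using truncation_pointwise_tail[OF sp(3) \<phi>(1), of "f x" k x "f y"] \<phi>_out[of y] \<phi>(1)[of x] sp
          by (simp add: E_def \<eta>_def w_def P_def)
      next
        case 3
        then show ?thesis
          using truncation_pointwise_tail[OF sp(3) \<phi>(1), of "f y" k y "f x"] \<phi>_out[of x] \<phi>(1)[of y] sp
          by (simp add: E_def \<eta>_def w_def P_def abs_minus_commute[of "f x"] algebra_simps)
      next
        case 4
        then show ?thesis
          using \<phi>_out sp by (simp add: E_def \<eta>_def)
      qed
    qed
    define G where "G x y = c * (\<bar>w x * \<phi> x - w y * \<phi> y\<bar> powr p * frac_kernel (s * p) x y)" for x y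
    define H where "H x y = Lam * ((E x y + E y x) * frac_kernel (s * p) x y)" for x y
    have Em [measurable]: "(\<lambda>z. E (fst z) (snd z)) \<in> borel_measurable (lborel \<Otimes>\<^sub>M lborel)"
      "(\<lambda>z. E (snd z) (fst z)) \<in> borel_measurable (lborel \<Otimes>\<^sub>M lborel)"
      unfolding E_def by measurable
    have Gm: "(\<lambda>z. G (fst z) (snd z)) \<in> borel_measurable (lborel \<Otimes>\<^sub>M lborel)"
      unfolding G_def by measurable
    have Hm: "(\<lambda>z. H (fst z) (snd z)) \<in> borel_measurable (lborel \<Otimes>\<^sub>M lborel)"
      unfolding H_def by measurable
    have "(\<integral>\<^sup>+ z. ennreal (G (fst z) (snd z)) \<partial>lebesgue) \<le> (\<integral>\<^sup>+ z. ennreal (H (fst z) (snd z)) \<partial>lebesgue)"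
    proof (rule nn_integral_le_of_integral_nonpos[OF F])
      show "(\<lambda>z. G (fst z) (snd z)) \<in> borel_measurable lebesgue" "(\<lambda>z. H (fst z) (snd z)) \<in> borel_measurable lebesgue"
        using Gm Hm unfolding lborel_prod by (auto intro: measurable_completion)
      show "0 \<le> G (fst z) (snd z)" for z
        using c by (simp add: G_def)
      show "0 \<le> H (fst z) (snd z)" for z
        using lam E by (simp add: H_def)
      have "AE z in lebesgue. lam \<le> K (fst z) (snd z) * norm (fst z - snd z) powr (real DIM('a) + s * p)
          \<and> K (fst z) (snd z) * norm (fst z - snd z) powr (real DIM('a) + s * p) \<le> Lam"
        using K by (simp add: admissible_kernel_def)
      then show "AE z in lebesgue. G (fst z) (snd z) \<le> energy_form p K u \<eta> z + H (fst z) (snd z)"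
        using AE_lebesgue_pair[OF ae]
      proof eventually_elim
        case (elim z)
        obtain x y where z: "z = (x, y)"
          by (cases z)
        define N where "N = norm (x - y) powr (real DIM('a) + s * p)"
        have Kb: "lam \<le> K x y * N" "K x y * N \<le> Lam" and uf: "u x = f x" "u y = f y"
          using elim by (auto simp: z N_def)
        \<comment> \<open>The diagonal needs no separate null-set argument: there N = 0, which
          contradicts the lower kernel bound since lam > 0.\<close>
        have "N \<noteq> 0"
          using Kb lam by auto
        then have N: "0 < N"
          by (simp add: N_def)
        have ker: "frac_kernel (s * p) x y = 1 / N"
          by (simp add: frac_kernel_def N_def)
        have Kk: "lam * frac_kernel (s * p) x y \<le> K x y" "K x y \<le> Lam * frac_kernel (s * p) x y"
          unfolding ker using Kb N by (auto simp: field_simps)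
        have K0: "0 \<le> K x y"
          using K by (simp add: admissible_kernel_def)
        \<comment> \<open>The energy integrand has no sign, so K itself must stay on it. The two
          kernel bounds are applied to the nonnegative terms G and E only.\<close>
        have "G x y = lam * frac_kernel (s * p) x y * (2 powr (- p - 1) * \<bar>w x * \<phi> x - w y * \<phi> y\<bar> powr p)"
          by (simp add: G_def c_def)
        also have "\<dots> \<le> K x y * (2 powr (- p - 1) * \<bar>w x * \<phi> x - w y * \<phi> y\<bar> powr p)"
          by (intro mult_right_mono Kk) auto
        also have "\<dots> \<le> K x y * (\<bar>f x - f y\<bar> powr (p - 2) * (f x - f y) * (\<eta> x - \<eta> y) + (E x y + E y x))"
          using pw[of x y] by (intro mult_left_mono K0) (simp only: diff_le_eq)
        also have "\<dots> = energy_form p K u \<eta> z + K x y * (E x y + E y x)"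
          by (simp add: energy_form_def z uf distrib_left mult.assoc)
        also have "K x y * (E x y + E y x) \<le> Lam * frac_kernel (s * p) x y * (E x y + E y x)"
          using E by (intro mult_right_mono Kk add_nonneg_nonneg) auto
        finally show ?case
          by (simp add: z H_def mult_ac)
      qed
    qed
    moreover have "(\<integral>\<^sup>+ z. ennreal (G (fst z) (snd z)) \<partial>lebesgue) = ennreal c * gagliardo s p (\<lambda>x. w x * \<phi> x)"
    proof -
      have "(\<integral>\<^sup>+ z. ennreal (G (fst z) (snd z)) \<partial>lebesgue) = (\<integral>\<^sup>+ x. \<integral>\<^sup>+ y. ennreal (G x y) \<partial>lborel \<partial>lborel)"
        by (rule nn_integral_lebesgue_pair) (use Gm in \<open>simp add: split_beta'\<close>)
      also have "\<dots> = ennreal c * gagliardo s p (\<lambda>x. w x * \<phi> x)"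
        using c by (simp add: G_def gagliardo_def ennreal_mult nn_integral_cmult)
      finally show ?thesis .
    qed
    moreover have "(\<integral>\<^sup>+ z. ennreal (H (fst z) (snd z)) \<partial>lebesgue)
      = ennreal (2 * Lam) * (\<integral>\<^sup>+ x. \<integral>\<^sup>+ y. ennreal (E x y * frac_kernel (s * p) x y) \<partial>lborel \<partial>lborel)"
    proof -
      \<comment> \<open>By Tonelli and the symmetry of the kernel, both halves of the error have
        this integral; hence the factor 2 in front of Lam.\<close>
      define I where "I = (\<integral>\<^sup>+ x. \<integral>\<^sup>+ y. ennreal (E x y * frac_kernel (s * p) x y) \<partial>lborel \<partial>lborel)"
      have "(\<integral>\<^sup>+ x. \<integral>\<^sup>+ y. ennreal (E y x * frac_kernel (s * p) x y) \<partial>lborel \<partial>lborel)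
        = (\<integral>\<^sup>+ y. \<integral>\<^sup>+ x. ennreal (E y x * frac_kernel (s * p) x y) \<partial>lborel \<partial>lborel)"
        by (rule lborel_pair.Fubini'[symmetric]) (use Em in \<open>simp add: split_beta'\<close>)
      also have "\<dots> = I"
        by (simp only: I_def frac_kernel_commute[of "s * p"])
      finally have swap: "(\<integral>\<^sup>+ x. \<integral>\<^sup>+ y. ennreal (E y x * frac_kernel (s * p) x y) \<partial>lborel \<partial>lborel) = I" .
      have "(\<integral>\<^sup>+ z. ennreal (H (fst z) (snd z)) \<partial>lebesgue) = (\<integral>\<^sup>+ x. \<integral>\<^sup>+ y. ennreal (H x y) \<partial>lborel \<partial>lborel)"
        by (rule nn_integral_lebesgue_pair) (use Hm in \<open>simp add: split_beta'\<close>)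
      also have "\<dots> = (\<integral>\<^sup>+ x. \<integral>\<^sup>+ y. ennreal Lam * (ennreal (E x y * frac_kernel (s * p) x y)
          + ennreal (E y x * frac_kernel (s * p) x y)) \<partial>lborel \<partial>lborel)"
        using lam E by (simp add: H_def ennreal_mult ennreal_plus distrib_right)
      also have "\<dots> = ennreal Lam * (I + I)"
      proof -
        have [measurable]: "(\<lambda>x. \<integral>\<^sup>+ y. ennreal (E x y * frac_kernel (s * p) x y) \<partial>lborel) \<in> borel_measurable lborel"
          "(\<lambda>x. \<integral>\<^sup>+ y. ennreal (E y x * frac_kernel (s * p) x y) \<partial>lborel) \<in> borel_measurable lborel"
          unfolding E_def by measurable
        have [measurable]: "(\<lambda>y. ennreal (E x y * frac_kernel (s * p) x y)) \<in> borel_measurable lborel"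
          "(\<lambda>y. ennreal (E y x * frac_kernel (s * p) x y)) \<in> borel_measurable lborel" for x
          unfolding E_def by measurable
        have "(\<integral>\<^sup>+ x. \<integral>\<^sup>+ y. ennreal Lam * (ennreal (E x y * frac_kernel (s * p) x y)
            + ennreal (E y x * frac_kernel (s * p) x y)) \<partial>lborel \<partial>lborel)
          = (\<integral>\<^sup>+ x. ennreal Lam * ((\<integral>\<^sup>+ y. ennreal (E x y * frac_kernel (s * p) x y) \<partial>lborel)
            + (\<integral>\<^sup>+ y. ennreal (E y x * frac_kernel (s * p) x y) \<partial>lborel)) \<partial>lborel)"
          by (simp add: nn_integral_cmult nn_integral_add)
        also have "\<dots> = ennreal Lam * (I + (\<integral>\<^sup>+ x. \<integral>\<^sup>+ y. ennreal (E y x * frac_kernel (s * p) x y) \<partial>lborel \<partial>lborel))"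
          unfolding I_def by (simp add: nn_integral_cmult nn_integral_add)
        finally show ?thesis
          unfolding swap .
      qed
      also have "\<dots> = ennreal (2 * Lam) * I"
        using lam by (simp add: ennreal_mult mult_2[symmetric] mult_ac)
      finally show ?thesis
        by (simp add: I_def)
    qed
    ultimately have main: "ennreal c * gagliardo s p (\<lambda>x. w x * \<phi> x)
      \<le> ennreal (2 * Lam) * (\<integral>\<^sup>+ x. \<integral>\<^sup>+ y. ennreal (E x y * frac_kernel (s * p) x y) \<partial>lborel \<partial>lborel)"
      by simp
    define l where "l = ((\<sigma> + d) / d) powr (real DIM('a) + s * p)"
    have l: "0 \<le> l"
      by (simp add: l_def)
    define T where "T = (\<integral>\<^sup>+ y. ennreal (w y powr (p - 1) * frac_kernel (s * p) x0 y) * indicator (- B) y \<partial>lborel)"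
    define Ip where "Ip = (\<integral>\<^sup>+ x. ennreal (w x powr p) * indicator B x \<partial>lborel)"
    define I1 where "I1 = (\<integral>\<^sup>+ x. ennreal (w x) * indicator B x \<partial>lborel)"
    have inner: "(\<integral>\<^sup>+ y. ennreal (E x y * frac_kernel (s * p) x y) \<partial>lborel)
      \<le> ennreal (P * C1 * d powr - (s * p)) * (ennreal (w x powr p) * indicator B x) + ennreal l * T * (ennreal (w x) * indicator B x)" for x
    proof (cases "x \<in> B")
      case False
      then show ?thesis
        using \<phi>_out[OF False] sp by (simp add: E_def)
    next
      case True
      have "(\<integral>\<^sup>+ y. ennreal (E x y * frac_kernel (s * p) x y) \<partial>lborel)
        \<le> (\<integral>\<^sup>+ y. ennreal (P * w x powr p) * ennreal (min 1 (norm (x - y) / d) powr p * frac_kernel (s * p) x y)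
          + ennreal (l * w x) * (ennreal (w y powr (p - 1) * frac_kernel (s * p) x0 y) * indicator (- B) y) \<partial>lborel)"
      proof (rule nn_integral_mono)
        fix y
        have "\<bar>\<phi> x - \<phi> y\<bar> powr p \<le> min 1 (norm (x - y) / d) powr p"
          using sp cutoff_diff_le[OF d] by (intro powr_mono2) (auto simp: \<phi>_def)
        then have a: "P * w x powr p * \<bar>\<phi> x - \<phi> y\<bar> powr p * frac_kernel (s * p) x y
          \<le> P * w x powr p * min 1 (norm (x - y) / d) powr p * frac_kernel (s * p) x y"
          using P by (intro mult_right_mono mult_left_mono) auto
        \<comment> \<open>Only pairs with \<phi> x > 0 and y outside B matter; then x is within
          \<sigma> of x0 and y at least \<sigma> + d away, as \<open>frac_kernel_offcentre\<close>
          requires.\<close>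
        have b: "w y powr (p - 1) * indicator (- B) y * (w x * \<phi> x powr p) * frac_kernel (s * p) x y
          \<le> w y powr (p - 1) * indicator (- B) y * w x * (l * frac_kernel (s * p) x0 y)"
        proof (cases "y \<in> B \<or> \<phi> x = 0")
          case True
          then show ?thesis
            using l w sp by auto
        next
          case False
          then have "frac_kernel (s * p) x y \<le> l * frac_kernel (s * p) x0 y"
            unfolding l_def using \<phi>_supp[of x] \<sigma> d sp'
            by (intro frac_kernel_offcentre) (auto simp: B_def dist_norm norm_minus_commute)
          moreover have "w x * \<phi> x powr p \<le> w x * 1"
            using w \<phi> by (intro mult_left_mono) auto
          ultimately show ?thesis
            using w by (intro mult_mono mult_left_mono) auto
        qed
        have "E x y * frac_kernel (s * p) x y
          \<le> P * w x powr p * (min 1 (norm (x - y) / d) powr p * frac_kernel (s * p) x y)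
            + l * w x * (w y powr (p - 1) * frac_kernel (s * p) x0 y * indicator (- B) y)"
          using add_mono[OF a b] True by (simp add: E_def algebra_simps)
        then have "ennreal (E x y * frac_kernel (s * p) x y)
          \<le> ennreal (P * w x powr p * (min 1 (norm (x - y) / d) powr p * frac_kernel (s * p) x y)
            + l * w x * (w y powr (p - 1) * frac_kernel (s * p) x0 y * indicator (- B) y))"
          by (rule ennreal_leI)
        also have "\<dots> = ennreal (P * w x powr p) * ennreal (min 1 (norm (x - y) / d) powr p * frac_kernel (s * p) x y)
          + ennreal (l * w x) * (ennreal (w y powr (p - 1) * frac_kernel (s * p) x0 y) * indicator (- B) y)"
          using P l w by (simp add: ennreal_plus ennreal_mult flip: ennreal_indicator)
        finally show "ennreal (E x y * frac_kernel (s * p) x y)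
          \<le> ennreal (P * w x powr p) * ennreal (min 1 (norm (x - y) / d) powr p * frac_kernel (s * p) x y)
          + ennreal (l * w x) * (ennreal (w y powr (p - 1) * frac_kernel (s * p) x0 y) * indicator (- B) y)" .
      qed
      also have "\<dots> = ennreal (P * w x powr p) * (\<integral>\<^sup>+ y. ennreal (min 1 (norm (x - y) / d) powr p * frac_kernel (s * p) x y) \<partial>lborel)
          + ennreal (l * w x) * T"
        unfolding T_def by (subst nn_integral_add) (auto simp: nn_integral_cmult)
      also have "\<dots> \<le> ennreal (P * w x powr p) * ennreal (C1 * d powr - (s * p)) + ennreal (l * w x) * T"
        by (intro add_right_mono mult_left_mono C1 d) auto
      also have "\<dots> = ennreal (P * C1 * d powr - (s * p)) * (ennreal (w x powr p) * indicator B x) + ennreal l * T * (ennreal (w x) * indicator B x)"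
        using True P C1 l w by (simp add: ennreal_mult mult_ac)
      finally show ?thesis .
    qed
    have "(\<integral>\<^sup>+ x. \<integral>\<^sup>+ y. ennreal (E x y * frac_kernel (s * p) x y) \<partial>lborel \<partial>lborel)
      \<le> (\<integral>\<^sup>+ x. ennreal (P * C1 * d powr - (s * p)) * (ennreal (w x powr p) * indicator B x) + ennreal l * T * (ennreal (w x) * indicator B x) \<partial>lborel)"
      by (intro nn_integral_mono inner)
    also have "\<dots> = ennreal (P * C1 * d powr - (s * p)) * Ip + ennreal l * T * I1"
      unfolding Ip_def I1_def by (subst nn_integral_add) (auto simp: nn_integral_cmult)
    also have "\<dots> \<le> ennreal (max (P * C1) 1) * (ennreal (d powr - (s * p)) * Ip) + ennreal (max (P * C1) 1) * (ennreal l * I1 * T)"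
    proof (intro add_mono)
      show "ennreal (P * C1 * d powr - (s * p)) * Ip \<le> ennreal (max (P * C1) 1) * (ennreal (d powr - (s * p)) * Ip)"
        unfolding mult.assoc[symmetric] using P C1
        by (intro mult_right_mono) (auto intro!: ennreal_leI mult_right_mono simp flip: ennreal_mult)
      have "1 * (ennreal l * T * I1) \<le> ennreal (max (P * C1) 1) * (ennreal l * T * I1)"
        by (intro mult_right_mono) (auto simp: ennreal_leI simp flip: ennreal_1)
      then show "ennreal l * T * I1 \<le> ennreal (max (P * C1) 1) * (ennreal l * I1 * T)"
        by (simp add: mult_ac)
    qed
    also have "\<dots> = ennreal (max (P * C1) 1) * (ennreal (d powr - (s * p)) * Ip + ennreal l * I1 * T)"
      by (simp add: distrib_left)
    finally have err: "(\<integral>\<^sup>+ x. \<integral>\<^sup>+ y. ennreal (E x y * frac_kernel (s * p) x y) \<partial>lborel \<partial>lborel)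
      \<le> ennreal (max (P * C1) 1) * (ennreal (d powr - (s * p)) * Ip + ennreal l * I1 * T)" .
    have "gagliardo s p (\<lambda>x. w x * \<phi> x) = ennreal (1 / c) * (ennreal c * gagliardo s p (\<lambda>x. w x * \<phi> x))"
      unfolding mult.assoc[symmetric] using c by (subst ennreal_mult[symmetric]) auto
    also have "\<dots> \<le> ennreal (1 / c) * (ennreal (2 * Lam) * (ennreal (max (P * C1) 1) * (ennreal (d powr - (s * p)) * Ip + ennreal l * I1 * T)))"
      by (intro mult_left_mono order_trans[OF main] err) auto
    also have "\<dots> = ennreal C * (ennreal (d powr - (s * p)) * Ip + ennreal l * I1 * T)"
    proof -
      have e1: "ennreal (1 / c * (2 * Lam)) = ennreal (1 / c) * ennreal (2 * Lam)"
        by (rule ennreal_mult) (use c lam in auto)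
      have e2: "ennreal C = ennreal (1 / c * (2 * Lam)) * ennreal (max (P * C1) 1)"
        unfolding C_def by (rule ennreal_mult) (use c lam in auto)
      show ?thesis
        unfolding e2 e1 by (simp only: mult.assoc)
    qed
    finally show "gagliardo s p (\<lambda>x. max (f x - k) 0 * cutoff x0 \<sigma> d x)
      \<le> ennreal C * (ennreal (d powr - (s * p)) * (\<integral>\<^sup>+ x. ennreal (max (f x - k) 0 powr p) * indicator (ball x0 (\<sigma> + d)) x \<partial>lborel)
        + ennreal (((\<sigma> + d) / d) powr (real DIM('a) + s * p))
          * (\<integral>\<^sup>+ x. ennreal (max (f x - k) 0) * indicator (ball x0 (\<sigma> + d)) x \<partial>lborel)
          * (\<integral>\<^sup>+ y. ennreal (max (f y - k) 0 powr (p - 1) * frac_kernel (s * p) x0 y) * indicator (- ball x0 (\<sigma> + d)) y \<partial>lborel))"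
      unfolding w_def \<phi>_def Ip_def I1_def T_def l_def B_def .
  qed
qed

section \<open>De Giorgi iteration\<close>

definition excess :: "real \<Rightarrow> ('a::euclidean_space \<Rightarrow> real) \<Rightarrow> 'a \<Rightarrow> real \<Rightarrow> real \<Rightarrow> ennreal" where
  "excess p f x0 k \<rho> = (\<integral>\<^sup>+ x. ennreal (max (f x - k) 0 powr p) * indicator (ball x0 \<rho>) x \<partial>lborel)"

lemma excess_mono:
  assumes "l \<le> k" "\<rho> \<le> \<rho>'" "0 \<le> p"
  shows "excess p f x0 k \<rho> \<le> excess p f x0 l \<rho>'"
  unfolding excess_def using assms
  by (intro nn_integral_mono mult_mono ennreal_leI powr_mono2) (auto split: split_indicator)

text \<open>Faber-Krahn and Caccioppoli are applied to the truncation at the higher level k, while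
  all data are measured at the lower level l. The gap h = k - l converts them: Chebyshev bounds the
  support by A / h^p, and the linear factor before the tail becomes A / h^(p-1). Of the width 2 d,
  one d is used by the cutoff and one by the gap to the far region.\<close>

lemma excess_improvement:
  fixes s p lam Lam :: real
  assumes sp: "0 < s" "s < 1" "1 < p" and lam: "1 \<le> lam" "lam \<le> Lam"
  obtains C where "0 < C" "\<And>(K :: 'a::euclidean_space \<Rightarrow> 'a \<Rightarrow> real) \<Omega> g u f k l x0 r \<rho> d A \<tau>.
    admissible_kernel s p lam Lam K \<Longrightarrow> weak_subsolution s p K \<Omega> g u \<Longrightarrow>
    f \<in> borel_measurable borel \<Longrightarrow> AE x in lebesgue. u x = f x \<Longrightarrow> 0 \<le> l \<Longrightarrow> l < k \<Longrightarrow>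
    0 < d \<Longrightarrow> 0 < \<rho> \<Longrightarrow> r / 2 \<le> \<rho> + 2 * d \<Longrightarrow> ball x0 (\<rho> + 2 * d) \<subseteq> \<Omega> \<Longrightarrow> 0 \<le> A \<Longrightarrow> 0 \<le> \<tau> \<Longrightarrow>
    excess p f x0 l (\<rho> + 2 * d) \<le> ennreal A \<Longrightarrow>
    (\<integral>\<^sup>+ y. ennreal (max (f y) 0 powr (p - 1) * frac_kernel (s * p) x0 y) * indicator (- ball x0 (r / 2)) y \<partial>lborel) \<le> ennreal \<tau> \<Longrightarrow>
    excess p f x0 k \<rho> \<le> ennreal (C * (d powr - (s * p) + ((\<rho> + 2 * d) / d) powr (real DIM('a) + s * p) * (\<tau> / (k - l) powr (p - 1)))
      * (A / (k - l) powr p) powr (s * p / real DIM('a)) * A)"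
proof -
  obtain C1 where C1: "0 < C1" and cacc: "\<And>(K :: 'a \<Rightarrow> 'a \<Rightarrow> real) \<Omega> g u f k x0 \<sigma> d.
    admissible_kernel s p lam Lam K \<Longrightarrow> weak_subsolution s p K \<Omega> g u \<Longrightarrow>
    f \<in> borel_measurable borel \<Longrightarrow> AE x in lebesgue. u x = f x \<Longrightarrow> 0 \<le> k \<Longrightarrow> 0 < d \<Longrightarrow> 0 < \<sigma> \<Longrightarrow>
    ball x0 (\<sigma> + d) \<subseteq> \<Omega> \<Longrightarrow>
    gagliardo s p (\<lambda>x. max (f x - k) 0 * cutoff x0 \<sigma> d x)
      \<le> ennreal C1 * (ennreal (d powr - (s * p)) * (\<integral>\<^sup>+ x. ennreal (max (f x - k) 0 powr p) * indicator (ball x0 (\<sigma> + d)) x \<partial>lborel)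
        + ennreal (((\<sigma> + d) / d) powr (real DIM('a) + s * p))
          * (\<integral>\<^sup>+ x. ennreal (max (f x - k) 0) * indicator (ball x0 (\<sigma> + d)) x \<partial>lborel)
          * (\<integral>\<^sup>+ y. ennreal (max (f y - k) 0 powr (p - 1) * frac_kernel (s * p) x0 y) * indicator (- ball x0 (\<sigma> + d)) y \<partial>lborel))"
    by (rule caccioppoli[OF sp lam, where 'a = 'a]) (rule that)
  obtain C2 where C2: "0 < C2" and fk: "\<And>(v :: 'a \<Rightarrow> real) m. v \<in> borel_measurable borel \<Longrightarrow> 0 < m \<Longrightarrow>
    emeasure lborel {x. v x \<noteq> 0} \<le> ennreal m \<Longrightarrow>
    (\<integral>\<^sup>+ x. ennreal (\<bar>v x\<bar> powr p) \<partial>lborel) \<le> ennreal (C2 * m powr (s * p / real DIM('a))) * gagliardo s p v"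
    by (rule fractional_faber_krahn[OF sp(1,3), where 'a = 'a]) (rule that)
  show ?thesis
  proof (rule that)
    show "0 < C1 * C2"
      using C1 C2 by simp
    fix K :: "'a \<Rightarrow> 'a \<Rightarrow> real" and \<Omega> :: "'a set" and g u f :: "'a \<Rightarrow> real" and k l r \<rho> d A \<tau> :: real and x0 :: 'a
    assume K: "admissible_kernel s p lam Lam K" and u: "weak_subsolution s p K \<Omega> g u"
      and f [measurable]: "f \<in> borel_measurable borel" and ae: "AE x in lebesgue. u x = f x"
      and l: "0 \<le> l" "l < k" and d: "0 < d" and \<rho>: "0 < \<rho>" "r / 2 \<le> \<rho> + 2 * d"
      and sub: "ball x0 (\<rho> + 2 * d) \<subseteq> \<Omega>" and A: "0 \<le> A" and \<tau>: "0 \<le> \<tau>"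
      and exc: "excess p f x0 l (\<rho> + 2 * d) \<le> ennreal A"
      and tail: "(\<integral>\<^sup>+ y. ennreal (max (f y) 0 powr (p - 1) * frac_kernel (s * p) x0 y) * indicator (- ball x0 (r / 2)) y \<partial>lborel) \<le> ennreal \<tau>"
    define B where "B = ball x0 (\<rho> + 2 * d)"
    have [measurable]: "B \<in> sets borel"
      by (simp add: B_def)
    have radius: "(\<rho> + d) + d = \<rho> + 2 * d"
      by simp
    define h where "h = k - l"
    have h: "0 < h"
      using l by (simp add: h_def)
    define v where "v x = max (f x - k) 0 * cutoff x0 (\<rho> + d) d x" for x
    have [measurable]: "v \<in> borel_measurable borel"
      unfolding v_def by measurable
    define q where "q = ((\<rho> + 2 * d) / d) powr (real DIM('a) + s * p)"
    define D where "D = d powr - (s * p) + q * (\<tau> / h powr (p - 1))"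
    have D: "0 \<le> D"
      using \<tau> by (simp add: D_def q_def)
    define \<beta> where "\<beta> = s * p / real DIM('a)"
    have exc': "(\<integral>\<^sup>+ x. ennreal (max (f x - l) 0 powr p) * indicator B x \<partial>lborel) \<le> ennreal A"
      using exc by (simp add: excess_def B_def)
    have cp: "excess p f x0 k (\<rho> + 2 * d) \<le> ennreal A"
      using excess_mono[of l k "\<rho> + 2 * d" "\<rho> + 2 * d" p f x0] exc l sp by simp
    \<comment> \<open>Where f > k, also f - l >= h, so f - k <= f - l <= (f - l)^p /
      h^(p-1).\<close>
    have I1: "(\<integral>\<^sup>+ x. ennreal (max (f x - k) 0) * indicator B x \<partial>lborel) \<le> ennreal (A / h powr (p - 1))"
    proof -
      have "(\<integral>\<^sup>+ x. ennreal (max (f x - k) 0) * indicator B x \<partial>lborel)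
        \<le> (\<integral>\<^sup>+ x. ennreal (1 / h powr (p - 1)) * (ennreal (max (f x - l) 0 powr p) * indicator B x) \<partial>lborel)"
      proof (rule nn_integral_mono)
        fix x
        have "max (f x - k) 0 \<le> 1 / h powr (p - 1) * max (f x - l) 0 powr p"
        proof (cases "f x \<le> k")
          case False
          define t where "t = f x - l"
          have t: "h \<le> t" "0 < t" "f x - k \<le> t"
            using False l by (auto simp: t_def h_def)
          have "h powr (p - 1) \<le> t powr (p - 1)"
            using t h sp by (intro powr_mono2) auto
          then have "h powr (p - 1) * t \<le> t powr (p - 1) * t"
            using t by (intro mult_right_mono) auto
          also have "\<dots> = t powr p"
            using t by (simp add: powr_minus_one_mult)
          finally have "t \<le> 1 / h powr (p - 1) * t powr p"
            using h by (simp add: field_simps)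
          moreover have "max (f x - k) 0 \<le> t" "max (f x - l) 0 = t"
            using t False l by (auto simp: t_def)
          ultimately show ?thesis
            by simp
        qed simp
        then show "ennreal (max (f x - k) 0) * indicator B x
          \<le> ennreal (1 / h powr (p - 1)) * (ennreal (max (f x - l) 0 powr p) * indicator B x)"
          by (simp add: ennreal_leI split: split_indicator flip: ennreal_mult)
      qed
      also have "\<dots> = ennreal (1 / h powr (p - 1)) * (\<integral>\<^sup>+ x. ennreal (max (f x - l) 0 powr p) * indicator B x \<partial>lborel)"
        by (rule nn_integral_cmult) measurable
      also have "\<dots> \<le> ennreal (1 / h powr (p - 1)) * ennreal A"
        by (intro mult_left_mono exc') auto
      also have "\<dots> = ennreal (A / h powr (p - 1))"
        using A by (simp flip: ennreal_mult)
      finally show ?thesis .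
    qed
    \<comment> \<open>Since k >= 0 and r/2 <= \<rho> + 2 d, both the integrand and the region
      shrink, so one \<tau> serves all levels and radii.\<close>
    have T: "(\<integral>\<^sup>+ y. ennreal (max (f y - k) 0 powr (p - 1) * frac_kernel (s * p) x0 y) * indicator (- B) y \<partial>lborel) \<le> ennreal \<tau>"
    proof (rule order_trans[OF _ tail], intro nn_integral_mono mult_mono ennreal_leI mult_right_mono powr_mono2)
      show "indicator (- B) y \<le> (indicator (- ball x0 (r / 2)) y :: ennreal)" for y
        using \<rho> by (auto simp: B_def split: split_indicator)
    qed (use sp l in auto)
    have gag: "gagliardo s p v \<le> ennreal (C1 * D * A)"
    proof -
      have "gagliardo s p v \<le> ennreal C1 * (ennreal (d powr - (s * p)) * excess p f x0 k (\<rho> + 2 * d)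
        + ennreal q * (\<integral>\<^sup>+ x. ennreal (max (f x - k) 0) * indicator B x \<partial>lborel)
          * (\<integral>\<^sup>+ y. ennreal (max (f y - k) 0 powr (p - 1) * frac_kernel (s * p) x0 y) * indicator (- B) y \<partial>lborel))"
        using cacc[OF K u f ae, of k d "\<rho> + d" x0, unfolded radius] l d \<rho> sub
        unfolding v_def excess_def B_def q_def by simp
      also have "\<dots> \<le> ennreal C1 * (ennreal (d powr - (s * p)) * ennreal A + ennreal q * ennreal (A / h powr (p - 1)) * ennreal \<tau>)"
        by (intro mult_left_mono add_mono mult_mono I1 T cp) auto
      also have "\<dots> = ennreal (C1 * (d powr - (s * p) * A + q * (A / h powr (p - 1)) * \<tau>))"
        using C1 A \<tau> by (simp add: ennreal_mult ennreal_plus q_def del: times_divide_eq_right times_divide_eq_left)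
      also have "C1 * (d powr - (s * p) * A + q * (A / h powr (p - 1)) * \<tau>) = C1 * D * A"
        by (simp add: D_def algebra_simps)
      finally show ?thesis .
    qed
    have le_v: "excess p f x0 k \<rho> \<le> (\<integral>\<^sup>+ x. ennreal (\<bar>v x\<bar> powr p) \<partial>lborel)"
      unfolding excess_def
    proof (rule nn_integral_mono)
      fix x
      show "ennreal (max (f x - k) 0 powr p) * indicator (ball x0 \<rho>) x \<le> ennreal (\<bar>v x\<bar> powr p)"
      proof (cases "x \<in> ball x0 \<rho>")
        case True
        then have "cutoff x0 (\<rho> + d) d x = 1"
          using d by (intro cutoff_eq_1) (auto simp: dist_norm norm_minus_commute)
        then show ?thesis
          using True by (simp add: v_def)
      qed simp
    qed
    have "excess p f x0 k \<rho> \<le> ennreal (C1 * C2 * D * (A / h powr p) powr \<beta> * A)"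
    \<comment> \<open>Faber-Krahn requires a positive measure bound, so A = 0 is settled by
      monotonicity of the excess.\<close>
    proof (cases "A = 0")
      case True
      then show ?thesis
        using excess_mono[of l k \<rho> "\<rho> + 2 * d" p f x0] exc l d sp by simp
    next
      case False
      then have m: "0 < A / h powr p"
        using A h by simp
      have supp: "emeasure lborel {x. v x \<noteq> 0} \<le> ennreal (A / h powr p)"
      proof -
        have "{x. v x \<noteq> 0} \<subseteq> {x \<in> B. k < f x}"
        proof safe
          fix x assume x: "v x \<noteq> 0"
          then have "\<not> \<rho> + d \<le> norm (x - x0)"
            using cutoff_eq_0[OF d, of "\<rho> + d" x x0] by (auto simp: v_def)
          then show "x \<in> B"
            using d by (simp add: B_def dist_norm norm_minus_commute)
          show "k < f x"
            using x by (auto simp: v_def max_def split: if_splits)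
        qed
        then have "emeasure lborel {x. v x \<noteq> 0} \<le> emeasure lborel {x \<in> B. k < f x}"
          by (intro emeasure_mono) measurable
        also have "\<dots> = (\<integral>\<^sup>+ x. indicator {x \<in> B. k < f x} x \<partial>lborel)"
          by (intro nn_integral_indicator[symmetric]) measurable
        also have "\<dots> \<le> (\<integral>\<^sup>+ x. ennreal (1 / h powr p) * (ennreal (max (f x - l) 0 powr p) * indicator B x) \<partial>lborel)"
        proof (rule nn_integral_mono)
          fix x
          show "indicator {x \<in> B. k < f x} x \<le> ennreal (1 / h powr p) * (ennreal (max (f x - l) 0 powr p) * indicator B x)"
          proof (cases "x \<in> B \<and> k < f x")
            case True
            then have "h powr p \<le> max (f x - l) 0 powr p"
              using h sp by (intro powr_mono2) (auto simp: h_def)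
            then have "1 \<le> 1 / h powr p * max (f x - l) 0 powr p"
              using h by (simp add: field_simps)
            then have "ennreal 1 \<le> ennreal (1 / h powr p * max (f x - l) 0 powr p)"
              by (rule ennreal_leI)
            then show ?thesis
              using True by (simp add: ennreal_mult'[symmetric])
          qed simp
        qed
        also have "\<dots> = ennreal (1 / h powr p) * (\<integral>\<^sup>+ x. ennreal (max (f x - l) 0 powr p) * indicator B x \<partial>lborel)"
          by (rule nn_integral_cmult) measurable
        also have "\<dots> \<le> ennreal (1 / h powr p) * ennreal A"
          by (intro mult_left_mono exc') auto
        also have "\<dots> = ennreal (A / h powr p)"
          using A by (simp flip: ennreal_mult)
        finally show ?thesis .
      qed
      have "excess p f x0 k \<rho> \<le> ennreal (C2 * (A / h powr p) powr \<beta>) * gagliardo s p v"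
        unfolding \<beta>_def by (rule order_trans[OF le_v fk[OF _ m supp]]) measurable
      also have "\<dots> \<le> ennreal (C2 * (A / h powr p) powr \<beta>) * ennreal (C1 * D * A)"
        by (intro mult_left_mono gag) auto
      also have "\<dots> = ennreal (C1 * C2 * D * (A / h powr p) powr \<beta> * A)"
        using C1 C2 D A by (simp add: mult_ac flip: ennreal_mult)
      finally show ?thesis .
    qed
    then show "excess p f x0 k \<rho> \<le> ennreal (C1 * C2 * (d powr - (s * p) + ((\<rho> + 2 * d) / d) powr (real DIM('a) + s * p) * (\<tau> / (k - l) powr (p - 1)))
      * (A / (k - l) powr p) powr (s * p / real DIM('a)) * A)"
      unfolding D_def q_def h_def \<beta>_def .
  qed
qed

text \<open>With \<open>Q = 2 ^ (j + 3)\<close> this is the \<open>j\<close>-th step of the iteration: radii differ by \<open>2 * r / Q\<close> and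
  levels by \<open>4 * k / Q\<close>.\<close>

lemma iteration_factor_le:
  fixes n a p \<beta> r k \<delta> Q A \<rho> \<tau> :: real
  assumes "0 < n" "0 < a" "1 < p" "0 < \<beta>" "0 < r" "0 < k" "0 < \<delta>" "\<delta> \<le> 1" "1 \<le> Q" "0 \<le> A"
    and \<rho>: "0 \<le> \<rho>" "\<rho> \<le> r" and \<tau>: "\<tau> = r powr - a * 2 powr a * (k / \<delta>) powr (p - 1)"
  shows "((r / Q) powr - a + (\<rho> / (r / Q)) powr (n + a) * (\<tau> / (4 * k / Q) powr (p - 1))) * (A / (4 * k / Q) powr p) powr \<beta>
    \<le> (1 + 2 powr a) * r powr - a * \<delta> powr - (p - 1) * (A / k powr p) powr \<beta> * Q powr (n + a + (p - 1) + p * \<beta>)"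
proof -
  define N where "N = n + a + (p - 1)"
  have "0 < Q"
    using assms by simp
  \<comment> \<open>Because \<delta> <= 1, the local term may be enlarged to carry the same factor
    \<delta>^(-(p-1)) as the tail term.\<close>
  have \<delta>1: "1 \<le> \<delta> powr - (p - 1)"
    using assms powr_mono'[of "- (p - 1)" 0 \<delta>] by simp
  have kQ: "0 < k / Q" "k / Q \<le> 4 * k / Q"
    using assms \<open>0 < Q\<close> by (auto intro: divide_right_mono)
  have 1: "(r / Q) powr - a \<le> r powr - a * \<delta> powr - (p - 1) * Q powr N"
  proof -
    have "(r / Q) powr - a = r powr - a * 1 * Q powr a"
      using \<open>0 < r\<close> \<open>0 < Q\<close> by (simp add: powr_divide powr_minus field_simps)
    also have "\<dots> \<le> r powr - a * \<delta> powr - (p - 1) * Q powr N"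
      using assms \<delta>1 by (intro mult_mono[OF mult_mono[OF order_refl]] powr_mono) (auto simp: N_def)
    finally show ?thesis .
  qed
  have 2: "(\<rho> / (r / Q)) powr (n + a) * (\<tau> / (4 * k / Q) powr (p - 1))
      \<le> 2 powr a * (r powr - a * \<delta> powr - (p - 1) * Q powr N)"
  proof -
    have "\<rho> / (r / Q) \<le> Q"
      using \<rho> \<open>0 < r\<close> \<open>0 < Q\<close> by (simp add: field_simps)
    then have A: "(\<rho> / (r / Q)) powr (n + a) \<le> Q powr (n + a)"
      using assms by (intro powr_mono2) auto
    have "(k / Q) powr (p - 1) \<le> (4 * k / Q) powr (p - 1)"
      using kQ assms by (intro powr_mono2) auto
    then have "\<tau> / (4 * k / Q) powr (p - 1) \<le> \<tau> / (k / Q) powr (p - 1)"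
      using kQ \<tau> assms by (intro divide_left_mono mult_pos_pos) auto
    also have "\<dots> = r powr - a * 2 powr a * ((k / \<delta>) powr (p - 1) / (k / Q) powr (p - 1))"
      by (simp add: \<tau>)
    \<comment> \<open>Here k cancels, which is why \<tau> is tied to k / \<delta>: the tail costs a
      fixed power of \<delta>, whatever the level.\<close>
    also have "(k / \<delta>) powr (p - 1) / (k / Q) powr (p - 1) = \<delta> powr - (p - 1) * Q powr (p - 1)"
      unfolding powr_divide powr_minus_divide using \<open>0 < k\<close> by (simp del: minus_diff_eq)
    finally have B: "\<tau> / (4 * k / Q) powr (p - 1) \<le> r powr - a * 2 powr a * (\<delta> powr - (p - 1) * Q powr (p - 1))" .
    have "(\<rho> / (r / Q)) powr (n + a) * (\<tau> / (4 * k / Q) powr (p - 1))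
      \<le> Q powr (n + a) * (r powr - a * 2 powr a * (\<delta> powr - (p - 1) * Q powr (p - 1)))"
      using A B by (rule mult_mono) (auto simp: \<tau>)
    also have "\<dots> = 2 powr a * (r powr - a * \<delta> powr - (p - 1) * (Q powr (n + a) * Q powr (p - 1)))"
      by (simp only: mult_ac)
    also have "Q powr (n + a) * Q powr (p - 1) = Q powr N"
      by (simp add: N_def powr_add)
    finally show ?thesis .
  qed
  have 3: "(A / (4 * k / Q) powr p) powr \<beta> \<le> (A / k powr p) powr \<beta> * Q powr (p * \<beta>)"
  proof -
    have "(k / Q) powr p \<le> (4 * k / Q) powr p"
      using kQ assms by (intro powr_mono2) auto
    then have "A / (4 * k / Q) powr p \<le> A / (k / Q) powr p"
      using kQ assms by (intro divide_left_mono mult_pos_pos) auto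
    then have "(A / (4 * k / Q) powr p) powr \<beta> \<le> (A / (k / Q) powr p) powr \<beta>"
      using assms by (intro powr_mono2) auto
    also have "A / (k / Q) powr p = A / k powr p * Q powr p"
      by (simp add: powr_divide)
    also have "(A / k powr p * Q powr p) powr \<beta> = (A / k powr p) powr \<beta> * Q powr (p * \<beta>)"
      by (simp only: powr_mult powr_powr)
    finally show ?thesis .
  qed
  have "((r / Q) powr - a + (\<rho> / (r / Q)) powr (n + a) * (\<tau> / (4 * k / Q) powr (p - 1))) * (A / (4 * k / Q) powr p) powr \<beta>
    \<le> (r powr - a * \<delta> powr - (p - 1) * Q powr N + 2 powr a * (r powr - a * \<delta> powr - (p - 1) * Q powr N))
      * ((A / k powr p) powr \<beta> * Q powr (p * \<beta>))"
    using add_mono[OF 1 2] 3 by (rule mult_mono) auto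
  also have "\<dots> = (1 + 2 powr a) * r powr - a * \<delta> powr - (p - 1) * (A / k powr p) powr \<beta> * (Q powr N * Q powr (p * \<beta>))"
    by (simp add: algebra_simps)
  also have "Q powr N * Q powr (p * \<beta>) = Q powr (n + a + (p - 1) + p * \<beta>)"
    by (simp add: N_def powr_add)
  finally show ?thesis .
qed

text \<open>The tail hypothesis says that the tail of the positive part of f is at most k /
  \<delta>; the last one makes k large against the mean of f_+^p. Together they make the first step
  contract, and geometric decay of the excess then propagates by induction.\<close>

lemma local_boundedness_borel:
  fixes s p lam Lam :: real
  assumes sp: "0 < s" "s < 1" "1 < p" and lam: "1 \<le> lam" "lam \<le> Lam"
  obtains C where "0 < C" "\<And>(K :: 'a::euclidean_space \<Rightarrow> 'a \<Rightarrow> real) \<Omega> g u f x0 r \<delta> k A.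
    admissible_kernel s p lam Lam K \<Longrightarrow> weak_subsolution s p K \<Omega> g u \<Longrightarrow>
    f \<in> borel_measurable borel \<Longrightarrow> AE x in lebesgue. u x = f x \<Longrightarrow> 0 < r \<Longrightarrow> ball x0 r \<subseteq> \<Omega> \<Longrightarrow>
    0 < \<delta> \<Longrightarrow> \<delta> \<le> 1 \<Longrightarrow> 0 < k \<Longrightarrow> 0 \<le> A \<Longrightarrow> excess p f x0 0 r \<le> ennreal A \<Longrightarrow>
    (\<integral>\<^sup>+ y. ennreal (max (f y) 0 powr (p - 1) * frac_kernel (s * p) x0 y) * indicator (- ball x0 (r / 2)) y \<partial>lborel)
      \<le> ennreal (r powr - (s * p) * 2 powr (s * p) * (k / \<delta>) powr (p - 1)) \<Longrightarrow>
    C * \<delta> powr - ((p - 1) * real DIM('a) / (s * p)) * (A / r powr real DIM('a)) \<le> k powr p \<Longrightarrow>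
    AE x in lborel. x \<in> ball x0 (r / 2) \<longrightarrow> f x \<le> k"
proof -
  define n where "n = real DIM('a)"
  define \<beta> where "\<beta> = s * p / n"
  have n: "0 < n" and \<beta>: "0 < \<beta>"
    using sp by (simp_all add: n_def \<beta>_def)
  define N where "N = n + s * p + (p - 1) + p * \<beta>"
  obtain C1 where C1: "0 < C1" and step: "\<And>(K :: 'a \<Rightarrow> 'a \<Rightarrow> real) \<Omega> g u f k l x0 r \<rho> d A \<tau>.
    admissible_kernel s p lam Lam K \<Longrightarrow> weak_subsolution s p K \<Omega> g u \<Longrightarrow>
    f \<in> borel_measurable borel \<Longrightarrow> AE x in lebesgue. u x = f x \<Longrightarrow> 0 \<le> l \<Longrightarrow> l < k \<Longrightarrow>
    0 < d \<Longrightarrow> 0 < \<rho> \<Longrightarrow> r / 2 \<le> \<rho> + 2 * d \<Longrightarrow> ball x0 (\<rho> + 2 * d) \<subseteq> \<Omega> \<Longrightarrow> 0 \<le> A \<Longrightarrow> 0 \<le> \<tau> \<Longrightarrow>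
    excess p f x0 l (\<rho> + 2 * d) \<le> ennreal A \<Longrightarrow>
    (\<integral>\<^sup>+ y. ennreal (max (f y) 0 powr (p - 1) * frac_kernel (s * p) x0 y) * indicator (- ball x0 (r / 2)) y \<partial>lborel) \<le> ennreal \<tau> \<Longrightarrow>
    excess p f x0 k \<rho> \<le> ennreal (C1 * (d powr - (s * p) + ((\<rho> + 2 * d) / d) powr (real DIM('a) + s * p) * (\<tau> / (k - l) powr (p - 1)))
      * (A / (k - l) powr p) powr (s * p / real DIM('a)) * A)"
    by (rule excess_improvement[OF sp lam, where 'a = 'a]) (rule that)
  \<comment> \<open>Chosen so that (\<theta>^j)^\<beta> = 2^(-j N), which cancels the growth Q^N =
    2^((j+3) N) of the step factor.\<close>
  define \<theta> where "\<theta> = 2 powr - (N / \<beta>)"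
  have "0 < N"
    unfolding N_def using n \<beta> sp by (intro add_pos_pos mult_pos_pos) auto
  then have \<theta>: "0 < \<theta>" "\<theta> < 1"
    using \<beta> powr_less_mono[of "- (N / \<beta>)" 0 2] by (auto simp: \<theta>_def)
  \<comment> \<open>The j-independent remainder 2^(3 N) of that cancellation, together with the
    constants of one step.\<close>
  define M where "M = C1 * (1 + 2 powr (s * p)) * 2 powr (3 * N)"
  have M: "0 < M"
    using C1 by (simp add: M_def add_pos_pos)
  define C where "C = (M / \<theta>) powr (1 / \<beta>)"
  have "0 < C"
    using M \<theta> by (simp add: C_def)
  show ?thesis
  proof (rule that[OF \<open>0 < C\<close>])
    fix K :: "'a \<Rightarrow> 'a \<Rightarrow> real" and \<Omega> :: "'a set" and g u f :: "'a \<Rightarrow> real" and r \<delta> k A :: real and x0 :: 'a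
    assume K: "admissible_kernel s p lam Lam K" and u: "weak_subsolution s p K \<Omega> g u"
      and f [measurable]: "f \<in> borel_measurable borel" and ae: "AE x in lebesgue. u x = f x"
      and r: "0 < r" and sub: "ball x0 r \<subseteq> \<Omega>" and \<delta>: "0 < \<delta>" "\<delta> \<le> 1" and k: "0 < k" and A: "0 \<le> A"
      and exc: "excess p f x0 0 r \<le> ennreal A"
      and tail: "(\<integral>\<^sup>+ y. ennreal (max (f y) 0 powr (p - 1) * frac_kernel (s * p) x0 y) * indicator (- ball x0 (r / 2)) y \<partial>lborel)
        \<le> ennreal (r powr - (s * p) * 2 powr (s * p) * (k / \<delta>) powr (p - 1))"
      and large: "C * \<delta> powr - ((p - 1) * real DIM('a) / (s * p)) * (A / r powr real DIM('a)) \<le> k powr p"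
    define \<tau> where "\<tau> = r powr - (s * p) * 2 powr (s * p) * (k / \<delta>) powr (p - 1)"
    \<comment> \<open>This is \<open>large\<close> raised to the power \<beta>: the exponents become
      -(p-1) for \<delta> and -s p for r, and C^\<beta> = M / \<theta>.\<close>
    have smallness: "M * r powr - (s * p) * \<delta> powr - (p - 1) * (A / k powr p) powr \<beta> \<le> \<theta>"
    proof -
      have kp: "0 < k powr p"
        using k by simp
      have "C * \<delta> powr - ((p - 1) / \<beta>) * r powr - n * (A / k powr p) \<le> 1"
        using large kp r unfolding \<beta>_def n_def
        by (simp add: powr_minus_divide[of r] field_simps)
      then have "(C * \<delta> powr - ((p - 1) / \<beta>) * r powr - n * (A / k powr p)) powr \<beta> \<le> 1"
        using \<open>0 < C\<close> A kp \<beta> by (intro powr_le1) auto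
      also have "(C * \<delta> powr - ((p - 1) / \<beta>) * r powr - n * (A / k powr p)) powr \<beta>
        = M / \<theta> * \<delta> powr - (p - 1) * r powr - (s * p) * (A / k powr p) powr \<beta>"
      proof -
        have "C powr \<beta> = M / \<theta>"
          using M \<theta> \<beta> by (simp add: C_def powr_powr)
        moreover have "- ((p - 1) / \<beta>) * \<beta> = - (p - 1)" "- n * \<beta> = - (s * p)"
          using sp n by (simp_all add: \<beta>_def)
        ultimately show ?thesis
          by (simp only: powr_mult powr_powr)
      qed
      finally have "M / \<theta> * \<delta> powr - (p - 1) * r powr - (s * p) * (A / k powr p) powr \<beta> \<le> 1" .
      then show ?thesis
        using \<theta> by (simp add: field_simps)
    qed
    \<comment> \<open>Radii fall from r to r/2 while levels rise from 0 to k, without reaching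
      either limit; all excesses therefore dominate the one at level k and radius r/2.\<close>
    define \<rho> where "\<rho> j = r / 2 * (1 + (1 / 2) ^ j)" for j :: nat
    define l where "l j = k * (1 - (1 / 2) ^ j)" for j :: nat
    have decay: "excess p f x0 (l j) (\<rho> j) \<le> ennreal (A * \<theta> ^ j)" for j
    proof (induction j)
      case 0
      then show ?case
        using exc by (simp add: l_def \<rho>_def)
    next
      case (Suc j)
      define Q :: real where "Q = 2 ^ (j + 3)"
      have Q: "1 \<le> Q" "0 < Q"
        by (simp_all add: Q_def)
      have half: "(1 / 2) ^ j \<le> (1 :: real)" "(1 / 2) ^ j = 8 / Q"
        by (simp_all add: power_le_one Q_def power_add field_simps)
      have diff: "l (Suc j) - l j = 4 * k / Q" "\<rho> (Suc j) + 2 * (r / Q) = \<rho> j"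
        unfolding l_def \<rho>_def power_Suc half(2) by (simp_all add: field_simps)
      have \<rho>r: "0 < \<rho> (Suc j)" "r / 2 \<le> \<rho> j" "\<rho> j \<le> r"
        using r half(1) unfolding \<rho>_def by (auto intro!: mult_pos_pos add_pos_pos)
      have "0 < 4 * k / Q"
        using k Q by simp
      then have "l j < l (Suc j)"
        unfolding diff(1)[symmetric] by simp
      moreover have "0 \<le> l j" "0 < r / Q" "0 \<le> A * \<theta> ^ j" "0 \<le> \<tau>"
        using k half(1) Q r A \<theta> by (simp_all add: l_def \<tau>_def)
      ultimately have pos: "0 \<le> l j" "l j < l (Suc j)" "0 < r / Q" "0 \<le> A * \<theta> ^ j" "0 \<le> \<tau>"
        by simp_all
      have one_step: "excess p f x0 (l (Suc j)) (\<rho> (Suc j)) \<le> ennreal (C1 * ((r / Q) powr - (s * p)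
          + (\<rho> j / (r / Q)) powr (n + s * p) * (\<tau> / (4 * k / Q) powr (p - 1)))
        * (A * \<theta> ^ j / (4 * k / Q) powr p) powr \<beta> * (A * \<theta> ^ j))"
        using step[OF K u f ae pos(1,2,3) \<rho>r(1), unfolded diff, OF \<rho>r(2) _ pos(4,5) Suc.IH]
          tail sub \<rho>r(3) unfolding \<tau>_def[symmetric] n_def[symmetric] \<beta>_def[symmetric] by force
      have factor: "C1 * ((r / Q) powr - (s * p)
          + (\<rho> j / (r / Q)) powr (n + s * p) * (\<tau> / (4 * k / Q) powr (p - 1)))
        * (A * \<theta> ^ j / (4 * k / Q) powr p) powr \<beta> * (A * \<theta> ^ j) \<le> \<theta> * (A * \<theta> ^ j)"
      proof (rule mult_right_mono[OF _ pos(4)])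
        have "((r / Q) powr - (s * p)
            + (\<rho> j / (r / Q)) powr (n + s * p) * (\<tau> / (4 * k / Q) powr (p - 1)))
          * (A * \<theta> ^ j / (4 * k / Q) powr p) powr \<beta>
          \<le> (1 + 2 powr (s * p)) * r powr - (s * p) * \<delta> powr - (p - 1) * (A * \<theta> ^ j / k powr p) powr \<beta> * Q powr N"
          unfolding N_def using n sp \<beta> r k \<delta> Q \<rho>r pos(4) by (intro iteration_factor_le) (auto simp: \<tau>_def)
        then have "C1 * ((r / Q) powr - (s * p)
            + (\<rho> j / (r / Q)) powr (n + s * p) * (\<tau> / (4 * k / Q) powr (p - 1)))
          * (A * \<theta> ^ j / (4 * k / Q) powr p) powr \<beta>
          \<le> C1 * ((1 + 2 powr (s * p)) * r powr - (s * p) * \<delta> powr - (p - 1) * (A * \<theta> ^ j / k powr p) powr \<beta> * Q powr N)"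
          unfolding mult.assoc using C1 by (intro mult_left_mono) auto
        \<comment> \<open>The decay from the induction hypothesis, raised to \<beta>, is what pays
          for the shrinking gaps.\<close>
        also have "(A * \<theta> ^ j / k powr p) powr \<beta> = (A / k powr p) powr \<beta> * 2 powr (- (real j * N))"
        proof -
          have "(\<theta> ^ j) powr \<beta> = 2 powr (- (N / \<beta>) * real j * \<beta>)"
            unfolding powr_realpow[OF \<theta>(1), symmetric] by (simp only: \<theta>_def powr_powr)
          also have "- (N / \<beta>) * real j * \<beta> = - (real j * N)"
            using \<beta> by simp
          finally have "(\<theta> ^ j) powr \<beta> = 2 powr (- (real j * N))" .
          moreover have "A * \<theta> ^ j / k powr p = A / k powr p * \<theta> ^ j"
            by simp
          ultimately show ?thesis
            by (simp only: powr_mult)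
        qed
        also have "C1 * ((1 + 2 powr (s * p)) * r powr - (s * p) * \<delta> powr - (p - 1) * ((A / k powr p) powr \<beta> * 2 powr (- (real j * N))) * Q powr N)
          = C1 * (1 + 2 powr (s * p)) * (2 powr (- (real j * N)) * Q powr N) * r powr - (s * p) * \<delta> powr - (p - 1) * (A / k powr p) powr \<beta>"
          by (simp only: mult_ac)
        also have "2 powr (- (real j * N)) * Q powr N = 2 powr (3 * N)"
        proof -
          have "Q powr N = 2 powr ((real j + 3) * N)"
            unfolding Q_def powr_realpow[OF zero_less_numeral, symmetric] powr_powr by simp
          then show ?thesis
            by (simp add: algebra_simps flip: powr_add)
        qed
        also have "C1 * (1 + 2 powr (s * p)) * 2 powr (3 * N) * r powr - (s * p) * \<delta> powr - (p - 1) * (A / k powr p) powr \<beta> \<le> \<theta>"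
          using smallness by (simp only: M_def)
        finally show "C1 * ((r / Q) powr - (s * p)
            + (\<rho> j / (r / Q)) powr (n + s * p) * (\<tau> / (4 * k / Q) powr (p - 1)))
          * (A * \<theta> ^ j / (4 * k / Q) powr p) powr \<beta> \<le> \<theta>" .
      qed
      show ?case
        using order_trans[OF one_step ennreal_leI[OF factor]] by (simp add: mult_ac)
    qed
    have "(\<lambda>j. ennreal (A * \<theta> ^ j)) \<longlonglongrightarrow> ennreal (A * 0)"
      using \<theta> by (intro tendsto_ennrealI tendsto_mult tendsto_const LIMSEQ_power_zero) auto
    moreover have "excess p f x0 k (r / 2) \<le> ennreal (A * \<theta> ^ j)" for j
      using excess_mono[of "l j" k "r / 2" "\<rho> j" p f x0] decay[of j] k r sp
      by (simp add: l_def \<rho>_def mult_le_cancel_left1)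
    ultimately have "excess p f x0 k (r / 2) \<le> ennreal (A * 0)"
      by (intro LIMSEQ_le_const) auto
    moreover have [measurable]: "ball x0 (r / 2) \<in> sets borel"
      by simp
    ultimately have "AE x in lborel. ennreal (max (f x - k) 0 powr p) * indicator (ball x0 (r / 2)) x = 0"
      unfolding excess_def by (subst nn_integral_0_iff_AE[symmetric]) auto
    then show "AE x in lborel. x \<in> ball x0 (r / 2) \<longrightarrow> f x \<le> k"
      by eventually_elim (auto simp: max_def split: if_splits)
  qed
qed

section \<open>Local boundedness\<close>

text \<open>Finiteness is essential, since a Bochner integral defaults to 0 on nonintegrable
  functions.\<close>

lemma nn_integral_eq_set_integral:
  fixes h :: "'b \<Rightarrow> real"
  assumes [measurable]: "h \<in> borel_measurable M" "S \<in> sets M" and h: "\<And>x. 0 \<le> h x"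
    and fin: "(\<integral>\<^sup>+ x. ennreal (h x) * indicator S x \<partial>M) < \<infinity>"
  shows "(\<integral>\<^sup>+ x. ennreal (h x) * indicator S x \<partial>M) = ennreal (\<integral>x\<in>S. h x \<partial>M)"
proof -
  have eq: "(\<integral>\<^sup>+ x. ennreal (indicator S x *\<^sub>R h x) \<partial>M) = (\<integral>\<^sup>+ x. ennreal (h x) * indicator S x \<partial>M)"
    by (intro nn_integral_cong) (auto split: split_indicator)
  have "integrable M (\<lambda>x. indicator S x *\<^sub>R h x)"
    using fin h unfolding eq[symmetric] by (intro integrableI_nonneg) auto
  then show ?thesis
    unfolding eq[symmetric] set_lebesgue_integral_def
    using h by (intro nn_integral_eq_integral) auto
qed

text \<open>Guarantees that \<open>Tail\<close> is the genuine tail and not a default value. Use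
  t^(p-1) <= 1 + t^p: away from x0 the kernel is integrable, by the cutoff bound with d = R, where
  the minimum is 1; it is also bounded, so t^p is integrable against it.\<close>

lemma tail_integral_finite:
  fixes f :: "'a::euclidean_space \<Rightarrow> real"
  assumes sp: "0 < s" "s < 1" "1 < p" and [measurable]: "f \<in> borel_measurable borel"
    and fin: "(\<integral>\<^sup>+ x. ennreal (\<bar>f x\<bar> powr p) \<partial>lborel) < \<infinity>" and R: "0 < R"
  shows "(\<integral>\<^sup>+ y. ennreal (max (f y) 0 powr (p - 1) * frac_kernel (s * p) x0 y) * indicator (- ball x0 R) y \<partial>lborel) < \<infinity>"
proof -
  have sp': "0 < s * p" "s * p < p"
    using sp by simp_all
  obtain C where C: "0 < C" "\<And>(x :: 'a) d. 0 < d \<Longrightarrow>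
    (\<integral>\<^sup>+ y. ennreal (min 1 (norm (x - y) / d) powr p * frac_kernel (s * p) x y) \<partial>lborel) \<le> ennreal (C * d powr - (s * p))"
    by (rule frac_kernel_cutoff_integrable[OF sp', where 'a = 'a]) (rule that)
  define c where "c = R powr - (real DIM('a) + s * p)"
  have "(\<integral>\<^sup>+ y. ennreal (max (f y) 0 powr (p - 1) * frac_kernel (s * p) x0 y) * indicator (- ball x0 R) y \<partial>lborel)
    \<le> (\<integral>\<^sup>+ y. ennreal (min 1 (norm (x0 - y) / R) powr p * frac_kernel (s * p) x0 y) + ennreal c * ennreal (\<bar>f y\<bar> powr p) \<partial>lborel)"
  proof (rule nn_integral_mono)
    fix y
    show "ennreal (max (f y) 0 powr (p - 1) * frac_kernel (s * p) x0 y) * indicator (- ball x0 R) y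
      \<le> ennreal (min 1 (norm (x0 - y) / R) powr p * frac_kernel (s * p) x0 y) + ennreal c * ennreal (\<bar>f y\<bar> powr p)"
    proof (cases "y \<in> ball x0 R")
      case False
      then have y: "R \<le> norm (x0 - y)"
        by (simp add: dist_norm)
      then have ker: "frac_kernel (s * p) x0 y \<le> c"
        unfolding c_def using R sp' by (intro frac_kernel_le) auto
      have "max (f y) 0 powr (p - 1) \<le> 1 + \<bar>f y\<bar> powr p"
      proof (cases "f y \<le> 1")
        case True
        then have "max (f y) 0 powr (p - 1) \<le> 1"
          using sp by (intro powr_le1) auto
        then show ?thesis
          by (rule order_trans) simp
      next
        case False
        then have "max (f y) 0 powr (p - 1) \<le> \<bar>f y\<bar> powr p"
          by (auto intro: powr_mono)
        then show ?thesis
          by simp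
      qed
      then have "max (f y) 0 powr (p - 1) * frac_kernel (s * p) x0 y \<le> (1 + \<bar>f y\<bar> powr p) * frac_kernel (s * p) x0 y"
        by (rule mult_right_mono) simp
      also have "\<dots> \<le> frac_kernel (s * p) x0 y + c * \<bar>f y\<bar> powr p"
        using mult_right_mono[OF ker, of "\<bar>f y\<bar> powr p"] by (simp add: algebra_simps)
      finally have "ennreal (max (f y) 0 powr (p - 1) * frac_kernel (s * p) x0 y)
        \<le> ennreal (frac_kernel (s * p) x0 y + c * \<bar>f y\<bar> powr p)"
        by (rule ennreal_leI)
      moreover have "min 1 (norm (x0 - y) / R) = 1"
        using y R by simp
      ultimately show ?thesis
        using False by (simp add: ennreal_mult ennreal_plus c_def)
    qed simp
  qed
  also have "\<dots> = (\<integral>\<^sup>+ y. ennreal (min 1 (norm (x0 - y) / R) powr p * frac_kernel (s * p) x0 y) \<partial>lborel)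
      + ennreal c * (\<integral>\<^sup>+ y. ennreal (\<bar>f y\<bar> powr p) \<partial>lborel)"
    by (subst nn_integral_add) (auto simp: nn_integral_cmult)
  also have "\<dots> < \<infinity>"
    using fin C(2)[OF R, of x0] by (auto simp: ennreal_mult_less_top intro: le_less_trans)
  finally show ?thesis .
qed

theorem theorem1p1:
  fixes s p lam Lam :: real
  assumes "0 < s" "s < 1" "1 < p" "1 \<le> lam" "lam \<le> Lam"
  shows "\<exists>c>0. \<forall>(K :: 'a::euclidean_space \<Rightarrow> 'a \<Rightarrow> real) (\<Omega> :: 'a set) g u x0 r \<delta>.
     admissible_kernel s p lam Lam K \<and> open \<Omega> \<and> bounded \<Omega> \<and> Wsp s p g
     \<and> weak_subsolution s p K \<Omega> g u
     \<and> 0 < r \<and> ball x0 r \<subseteq> \<Omega> \<and> 0 < \<delta> \<and> \<delta> \<le> 1 \<longrightarrow>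
     esssup (restrict_space lebesgue (ball x0 (r / 2))) (\<lambda>x. ereal (u x))
       \<le> ereal (\<delta> * Tail s p (\<lambda>x. max (u x) 0) x0 (r / 2)
          + c * \<delta> powr (- ((p - 1) * real DIM('a) / (s * p\<^sup>2)))
            * ((1 / measure lebesgue (ball x0 r))
                 * (\<integral>x \<in> ball x0 r. (max (u x) 0) powr p \<partial>lebesgue)) powr (1 / p))"
proof -
  note sp = assms(1-3) and lam = assms(4,5)
  define n where "n = real DIM('a)"
  define \<omega> where "\<omega> = unit_ball_vol n"
  have \<omega>: "0 < \<omega>"
    by (simp add: \<omega>_def n_def)
  obtain C where C: "0 < C" and bound: "\<And>(K :: 'a \<Rightarrow> 'a \<Rightarrow> real) \<Omega> g u f x0 r \<delta> k A.
    admissible_kernel s p lam Lam K \<Longrightarrow> weak_subsolution s p K \<Omega> g u \<Longrightarrow>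
    f \<in> borel_measurable borel \<Longrightarrow> AE x in lebesgue. u x = f x \<Longrightarrow> 0 < r \<Longrightarrow> ball x0 r \<subseteq> \<Omega> \<Longrightarrow>
    0 < \<delta> \<Longrightarrow> \<delta> \<le> 1 \<Longrightarrow> 0 < k \<Longrightarrow> 0 \<le> A \<Longrightarrow> excess p f x0 0 r \<le> ennreal A \<Longrightarrow>
    (\<integral>\<^sup>+ y. ennreal (max (f y) 0 powr (p - 1) * frac_kernel (s * p) x0 y) * indicator (- ball x0 (r / 2)) y \<partial>lborel)
      \<le> ennreal (r powr - (s * p) * 2 powr (s * p) * (k / \<delta>) powr (p - 1)) \<Longrightarrow>
    C * \<delta> powr - ((p - 1) * real DIM('a) / (s * p)) * (A / r powr real DIM('a)) \<le> k powr p \<Longrightarrow>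
    AE x in lborel. x \<in> ball x0 (r / 2) \<longrightarrow> f x \<le> k"
    by (rule local_boundedness_borel[OF sp lam, where 'a = 'a]) (rule that)
  \<comment> \<open>The factor \<omega> turns A / r^n into the mean over the ball, whose volume is
    \<omega> r^n.\<close>
  define c where "c = (C * \<omega>) powr (1 / p)"
  have c: "0 < c"
    using C \<omega> by (simp add: c_def)
  show ?thesis
  proof (intro exI[of _ c] conjI c allI impI, elim conjE)
    fix K :: "'a \<Rightarrow> 'a \<Rightarrow> real" and \<Omega> :: "'a set" and g u :: "'a \<Rightarrow> real" and x0 :: 'a and r \<delta> :: real
    assume K: "admissible_kernel s p lam Lam K" and u: "weak_subsolution s p K \<Omega> g u"
      and r: "0 < r" and sub: "ball x0 r \<subseteq> \<Omega>" and \<delta>: "0 < \<delta>" "\<delta> \<le> 1"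
    have W: "Wsp s p u"
      using u by (simp add: weak_subsolution_def Kminus_def)
    then have um [measurable]: "u \<in> borel_measurable lebesgue"
      by (simp add: Wsp_def)
    obtain f where f [measurable]: "f \<in> borel_measurable borel" and "AE x in lborel. u x = f x"
      using completion_ex_borel_measurable_real[OF um] by auto
    then have ae: "AE x in lebesgue. u x = f x"
      by (intro AE_completion)
    have "Wsp s p f"
      by (rule Wsp_cong_AE[OF W ae]) (auto intro: measurable_completion)
    then have fin: "(\<integral>\<^sup>+ x. ennreal (\<bar>f x\<bar> powr p) \<partial>lborel) < \<infinity>"
      by (simp add: Wsp_borel_iff)
    define T where "T = Tail s p (\<lambda>x. max (u x) 0) x0 (r / 2)"
    define \<tau> where "\<tau> = (\<integral>x \<in> - ball x0 (r / 2). \<bar>max (u x) 0\<bar> powr (p - 1) / norm (x - x0) powr (real DIM('a) + s * p) \<partial>lebesgue)"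
    define A where "A = (\<integral>x \<in> ball x0 r. (max (u x) 0) powr p \<partial>lebesgue)"
    have A: "0 \<le> A" and \<tau>0: "0 \<le> \<tau>"
      unfolding A_def \<tau>_def set_lebesgue_integral_def by (auto intro!: integral_nonneg_AE)
    have exc: "excess p f x0 0 r = ennreal A"
    proof -
      have eq: "excess p f x0 0 r = (\<integral>\<^sup>+ x. ennreal (max (u x) 0 powr p) * indicator (ball x0 r) x \<partial>lebesgue)"
        unfolding excess_def nn_integral_completion[of lborel, symmetric] using ae
        by (intro nn_integral_cong_AE) auto
      have "excess p f x0 0 r \<le> (\<integral>\<^sup>+ x. ennreal (\<bar>f x\<bar> powr p) \<partial>lborel)"
        unfolding excess_def
      proof (rule nn_integral_mono)
        fix x
        have "max (f x - 0) 0 powr p \<le> \<bar>f x\<bar> powr p"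
          using sp by (intro powr_mono2) auto
        then show "ennreal (max (f x - 0) 0 powr p) * indicator (ball x0 r) x \<le> ennreal (\<bar>f x\<bar> powr p)"
          by (auto simp: ennreal_leI split: split_indicator)
      qed
      then have "excess p f x0 0 r < \<infinity>"
        using fin by (rule le_less_trans)
      then show ?thesis
        unfolding A_def eq by (intro nn_integral_eq_set_integral) auto
    qed
    let ?tail = "\<integral>\<^sup>+ y. ennreal (max (f y) 0 powr (p - 1) * frac_kernel (s * p) x0 y) * indicator (- ball x0 (r / 2)) y \<partial>lborel"
    have tail: "?tail = ennreal \<tau>"
    proof -
      define h where "h x = \<bar>max (u x) 0\<bar> powr (p - 1) / norm (x - x0) powr (real DIM('a) + s * p)" for x
      have [measurable]: "(\<lambda>x. norm (x - x0)) \<in> borel_measurable lebesgue"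
        by (rule measurable_completion) measurable
      have [measurable]: "h \<in> borel_measurable lebesgue"
        unfolding h_def by measurable
      have eq: "?tail = (\<integral>\<^sup>+ x. ennreal (h x) * indicator (- ball x0 (r / 2)) x \<partial>lebesgue)"
        unfolding nn_integral_completion[of lborel, symmetric] h_def frac_kernel_def using ae
        by (intro nn_integral_cong_AE) (auto simp: norm_minus_commute)
      have "?tail < \<infinity>"
        by (rule tail_integral_finite[OF sp f fin]) (use r in simp)
      then show ?thesis
        unfolding \<tau>_def h_def[symmetric] eq by (intro nn_integral_eq_set_integral) (auto simp: h_def)
    qed
    \<comment> \<open>The factor 2^(s p) comes from the tail being taken at radius r/2 while the
      iteration is scaled by r.\<close>
    have T: "0 \<le> T" "\<tau> = r powr - (s * p) * 2 powr (s * p) * T powr (p - 1)"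
    proof -
      show "0 \<le> T"
        by (simp add: T_def Tail_def)
      have "T powr (p - 1) = (r / 2) powr (s * p) * \<tau>"
        using sp \<tau>0 by (simp add: T_def Tail_def \<tau>_def powr_powr)
      then show "\<tau> = r powr - (s * p) * 2 powr (s * p) * T powr (p - 1)"
        using r by (simp add: powr_divide powr_minus field_simps)
    qed
    have vol: "measure lebesgue (ball x0 r) = \<omega> * r powr n"
      using content_ball[of r x0] r by (simp add: \<omega>_def n_def powr_realpow)
    define X where "X = c * \<delta> powr (- ((p - 1) * n / (s * p\<^sup>2))) * (1 / (\<omega> * r powr n) * A) powr (1 / p)"
    have X: "0 \<le> X" "X powr p = C * \<delta> powr - ((p - 1) * n / (s * p)) * (A / r powr n)"
    proof -
      show "0 \<le> X"
        using c by (simp add: X_def)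
      have "- ((p - 1) * n / (s * p\<^sup>2)) * p = - ((p - 1) * n / (s * p))"
        using sp by (simp add: power2_eq_square)
      then have "X powr p = (C * \<omega>) * \<delta> powr - ((p - 1) * n / (s * p)) * (1 / (\<omega> * r powr n) * A)"
        unfolding X_def c_def powr_mult powr_powr using sp C \<omega> A r by (simp add: powr_mult)
      then show "X powr p = C * \<delta> powr - ((p - 1) * n / (s * p)) * (A / r powr n)"
        using \<omega> by (simp add: field_simps)
    qed
    have "esssup (restrict_space lebesgue (ball x0 (r / 2))) (\<lambda>x. ereal (u x)) \<le> ereal (\<delta> * T + X)"
    proof (rule ereal_le_epsilon2)
      fix \<epsilon> :: real assume \<epsilon>: "0 < \<epsilon>"
      \<comment> \<open>The summand \<epsilon> keeps k positive when \<delta> T + X vanishes, as the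
        iteration divides by k; letting \<epsilon> tend to 0 removes it.\<close>
      define k where "k = \<delta> * T + X + \<epsilon>"
      have "0 \<le> \<delta> * T"
        using \<delta> T(1) by simp
      then have k: "0 < k" "\<delta> * T \<le> k" "X \<le> k"
        using X(1) \<epsilon> by (simp_all add: k_def)
      then have "T \<le> k / \<delta>"
        using \<delta> by (simp add: pos_le_divide_eq mult.commute)
      have "AE x in lborel. x \<in> ball x0 (r / 2) \<longrightarrow> f x \<le> k"
      proof (rule bound[OF K u f ae r sub \<delta> k(1) A])
        show "excess p f x0 0 r \<le> ennreal A"
          by (simp add: exc)
        have "T powr (p - 1) \<le> (k / \<delta>) powr (p - 1)"
          using T(1) \<open>T \<le> k / \<delta>\<close> sp by (intro powr_mono2) auto
        then show "?tail \<le> ennreal (r powr - (s * p) * 2 powr (s * p) * (k / \<delta>) powr (p - 1))"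
          unfolding tail T(2) by (intro ennreal_leI mult_left_mono) auto
        have "X powr p \<le> k powr p"
          using X k sp by (intro powr_mono2) auto
        then show "C * \<delta> powr - ((p - 1) * real DIM('a) / (s * p)) * (A / r powr real DIM('a)) \<le> k powr p"
          unfolding X(2) n_def .
      qed
      then have "AE x in lebesgue. x \<in> ball x0 (r / 2) \<longrightarrow> f x \<le> k"
        by (rule AE_completion)
      then have "AE x in lebesgue. x \<in> ball x0 (r / 2) \<longrightarrow> ereal (u x) \<le> ereal (\<delta> * T + X) + ereal \<epsilon>"
        using ae by eventually_elim (simp add: k_def)
      then have "AE x in restrict_space lebesgue (ball x0 (r / 2)). ereal (u x) \<le> ereal (\<delta> * T + X) + ereal \<epsilon>"
        by (subst AE_restrict_space_iff) auto
      then show "esssup (restrict_space lebesgue (ball x0 (r / 2))) (\<lambda>x. ereal (u x)) \<le> ereal (\<delta> * T + X) + ereal \<epsilon>"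
        by (intro esssup_I measurable_restrict_space1) auto
    qed
    then show "esssup (restrict_space lebesgue (ball x0 (r / 2))) (\<lambda>x. ereal (u x))
       \<le> ereal (\<delta> * Tail s p (\<lambda>x. max (u x) 0) x0 (r / 2)
          + c * \<delta> powr (- ((p - 1) * real DIM('a) / (s * p\<^sup>2)))
            * ((1 / measure lebesgue (ball x0 r))
                 * (\<integral>x \<in> ball x0 r. (max (u x) 0) powr p \<partial>lebesgue)) powr (1 / p))"
      unfolding vol X_def T_def A_def n_def .
  qed
qed

end
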